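(* Assume that: (1) for each $i\in\mathcal I$, $J_i$ is continuously differentiable and convex in $x_i$ for given $x_{-i}$; the set $\mathcal X$ satisfies Slater's condition; and $G$ has full row rank; (2) the pseudo-gradient $F$ is $\mu$-strongly monotone and $\theta$-Lipschitz continuous on $\mathbb R^n$ ($\mu,\theta>0$); (3) the communication graph $\mathcal G$ is undirected and connected. Consider the dynamics $$\dot x=-F(x)-G_d^\top\lambda,\qquad \dot z=L\lambda,$$ $$\lambda=\operatorname*{arg\,min}_{\lambda\ge 0}\ \tfrac12\|G_d^\top\lambda\|^2+\lambda^\top\big[G_dF(x)-\alpha(G_dx-H_s)+Lz\big]+\tfrac12\lambda^\top L\lambda .$$ If $\alpha>\frac{\theta^2}{4\mu}$, then for any feasible initial condition $x(0)\in\mathcal X$ (and any $z(0)\in\mathbb R^{Nm}$), the decision variable $x(t)$ converges asymptotically (as $t\to\infty$) to the v-GNE of the game, and the constraint set $\mathcal X$ is forward invariant, i.e. $x(t)\in\mathcal X$ for all $t\ge0$.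
   Context: Game. There are $N$ players indexed by $\mathcal I=\{1,\dots,N\}$. Player $i$ chooses $x_i\in\mathbb R^{n_i}$; $n=\sum_i n_i$; $x=\mathrm{col}\{x_i\}_{i\in\mathcal I}\in\mathbb R^n$ is the stacked vector and $x_{-i}$ the stacked vector of the decisions of all players other than $i$. Player $i$ has objective $J_i(x_i,x_{-i})$, and local constraint data $g_i\in\mathbb R^{m\times n_i}$, $h_i\in\mathbb R^m$. Put $G=[g_1\ \cdots\ g_N]$, $H=\sum_i h_i$, $\mathcal X=\{x\in\mathbb R^n\mid Gx-H\le 0\}$, $G_d=\mathrm{diag}\{g_i\}_{i\in\mathcal I}$ (block diagonal), $H_s=\mathrm{col}\{h_i\}_{i\in\mathcal I}$. Inequalities between vectors are entrywise. The game is: for each $i$, $\min_{x_i\in\mathbb R^{n_i}} J_i(x_i,x_{-i})$ subject to $(x_i,x_{-i})\in\mathcal X$. A GNE is $x^*$ such that, for all $i$, $x_i^*$ minimizes $J_i(x_i,x_{-i}^* )$ over $x_i$ with $(x_i,x_{-i}^* )\in\mathcal X$. Pseudo-gradient: $F(x)=\mathrm{col}\{\nabla_{x_i}J_i(x_i,x_{-i})\}_{i\in\mathcal I}$. $\mu$-strongly monotone: $(F(x)-F(y))^\top(x-y)\ge\mu\|x-y\|^2$ for all $x,y\in\mathbb R^n$. $\theta$-Lipschitz: $\|F(x)-F(y)\|\le\theta\|x-y\|$ for all $x,y\in\mathbb R^n$. v-GNE (variational GNE): a GNE that is a solution of the variational inequality VI$(\mathcal X,F)$, i.e. $x^*\in\mathcal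 X$ with $(x-x^* )^\top F(x^* )\ge0$ for all $x\in\mathcal X$; equivalently, the KKT conditions $\nabla_{x_i}J_i(x_i^*,x_{-i}^* )+g_i^\top\lambda_i^*=0$, $0\le\lambda_i^*\perp(H-Gx^* )\ge0$ hold for all $i$ with identical multipliers $\lambda_i^*=\underline\lambda\in\mathbb R^m_+$ for all $i$. Communication graph: $\mathcal G$ is an undirected weighted graph on $\mathcal I$ with symmetric adjacency matrix $\mathcal A=[a_{ij}]$, $a_{ij}\geq 0$, $a_{ii}=0$, $a_{ij}>0$ iff $(i,j)$ is an edge; Laplacian $\mathcal L=\mathrm{diag}\{\mathcal A\mathbf 1_N\}-\mathcal A$; $L=\mathcal L\otimes I_m$. The variables $z=\mathrm{col}\{z_i\}$ and $\lambda=\mathrm{col}\{\lambda_i\}$ have $z_i,\lambda_i\in\mathbb R^m$. $\alpha>0$ is a constant parameter. *)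

theory Defs
  imports "HOL-Analysis.Analysis"
begin

(* The players form the finite type 'p.  The finite type 'n indexes the coordinates of the
   stacked decision vector x, and own k is the player to whom coordinate k belongs.  So x_i
   is the family of the x $ k with own k = i, and n_i = card {k. own k = i}.  Likewise G is
   given as a whole and g_i consists of the columns k of G with own k = i. *)

(* The vector (y_i, x_{-i}); it depends on y only through the block y_i. *)
definition repl :: "('n \<Rightarrow> 'p) \<Rightarrow> 'p \<Rightarrow> real^'n \<Rightarrow> real^'n \<Rightarrow> real^'n" where
  "repl own i y x = (\<chi> k. if own k = i then y $ k else x $ k)"

definition grad :: "('a::real_inner \<Rightarrow> real) \<Rightarrow> 'a \<Rightarrow> 'a" where
  "grad f x = (THE D. GDERIV f x :> D)"

(* The function y_i \<mapsto> f (y_i, x_{-i}), written as a function of a full vector y whose other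
   blocks are ignored.  Its gradient is the partial gradient with respect to block i, padded
   with zeros outside of block i; convexity and continuous differentiability in y are
   the same as in y_i. *)
definition block_fun ::
  "('n \<Rightarrow> 'p) \<Rightarrow> 'p \<Rightarrow> (real^'n \<Rightarrow> real) \<Rightarrow> real^'n \<Rightarrow> real^'n \<Rightarrow> real" where
  "block_fun own i f x = (\<lambda>y. f (repl own i y x))"

definition C1 :: "('a::real_inner \<Rightarrow> real) \<Rightarrow> bool" where
  "C1 f \<longleftrightarrow> (\<forall>x. f differentiable (at x)) \<and> continuous_on UNIV (grad f)"

definition pseudo_gradient ::
  "('n::finite \<Rightarrow> 'p) \<Rightarrow> ('p \<Rightarrow> real^'n \<Rightarrow> real) \<Rightarrow> real^'n \<Rightarrow> real^'n" where
  "pseudo_gradient own J x = (\<chi> k. grad (block_fun own (own k) (J (own k)) x) x $ k)"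

definition strongly_monotone :: "real \<Rightarrow> ('a::real_inner \<Rightarrow> 'a) \<Rightarrow> bool" where
  "strongly_monotone \<mu> F \<longleftrightarrow> (\<forall>x y. (F x - F y) \<bullet> (x - y) \<ge> \<mu> * (norm (x - y))\<^sup>2)"

(* On vectors, \<le> is the library's entrywise order. *)
definition feasible_set ::
  "real^'n^'m \<Rightarrow> ('p::finite \<Rightarrow> real^'m) \<Rightarrow> (real^'n) set" where
  "feasible_set G h = {x. G *v x - (\<Sum>i\<in>UNIV. h i) \<le> 0}"

definition slater :: "real^'n^'m \<Rightarrow> ('p::finite \<Rightarrow> real^'m) \<Rightarrow> bool" where
  "slater G h \<longleftrightarrow> (\<exists>x. \<forall>r. (G *v x - (\<Sum>i\<in>UNIV. h i)) $ r < 0)"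

definition is_GNE ::
  "('n::finite \<Rightarrow> 'p) \<Rightarrow> ('p \<Rightarrow> real^'n \<Rightarrow> real) \<Rightarrow> (real^'n) set \<Rightarrow> real^'n \<Rightarrow> bool" where
  "is_GNE own J X xs \<longleftrightarrow>
     (\<forall>i. is_arg_min (block_fun own i (J i) xs) (\<lambda>y. repl own i y xs \<in> X) xs)"

definition solves_VI :: "'a::real_inner set \<Rightarrow> ('a \<Rightarrow> 'a) \<Rightarrow> 'a \<Rightarrow> bool" where
  "solves_VI X F xs \<longleftrightarrow> xs \<in> X \<and> (\<forall>x\<in>X. (x - xs) \<bullet> F xs \<ge> 0)"

definition is_vGNE ::
  "('n::finite \<Rightarrow> 'p) \<Rightarrow> ('p \<Rightarrow> real^'n \<Rightarrow> real) \<Rightarrow> (real^'n) set \<Rightarrow> real^'n \<Rightarrow> bool" where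
  "is_vGNE own J X xs \<longleftrightarrow> is_GNE own J X xs \<and> solves_VI X (pseudo_gradient own J) xs"

(* Vectors of R^(N m) are indexed by 'p \<times> 'm, entry (i, r) being entry r of block i. *)

definition block_diag ::
  "('n \<Rightarrow> 'p::finite) \<Rightarrow> real^'n^'m::finite \<Rightarrow> real^'n^('p \<times> 'm)" where
  "block_diag own G = (\<chi> ir k. if own k = fst ir then G $ snd ir $ k else 0)"

definition col_stack :: "('p::finite \<Rightarrow> real^'m::finite) \<Rightarrow> real^('p \<times> 'm)" where
  "col_stack h = (\<chi> ir. h (fst ir) $ snd ir)"

definition weighted_graph :: "real^'p^'p \<Rightarrow> bool" where
  "weighted_graph A \<longleftrightarrow>
     transpose A = A \<and> (\<forall>i j. A $ i $ j \<ge> 0) \<and> (\<forall>i. A $ i $ i = 0)"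

definition connected_graph :: "real^'p^'p \<Rightarrow> bool" where
  "connected_graph A \<longleftrightarrow> (\<forall>i j. (i, j) \<in> {(a, b). A $ a $ b > 0}\<^sup>*)"

definition laplacian :: "real^'p^'p \<Rightarrow> real^'p^'p" where
  "laplacian A = (\<chi> i j. if i = j then (A *v 1) $ i else 0) - A"

(* The Kronecker product of M with the identity matrix of size m. *)
definition kron_id :: "real^'p^'p::finite \<Rightarrow> real^('p \<times> 'm::finite)^('p \<times> 'm)" where
  "kron_id M = (\<chi> ir js. if snd ir = snd js then M $ fst ir $ fst js else 0)"

definition multiplier_cost ::
  "real^'n^('p::finite \<times> 'm::finite) \<Rightarrow> real^('p \<times> 'm) \<Rightarrow> real^('p \<times> 'm)^('p \<times> 'm) \<Rightarrow> real
   \<Rightarrow> (real^'n \<Rightarrow> real^'n) \<Rightarrow> real^'n \<Rightarrow> real^('p \<times> 'm) \<Rightarrow> real^('p \<times> 'm) \<Rightarrow> real" where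
  "multiplier_cost Gd Hs L \<alpha> F x z l =
     1/2 * (norm (transpose Gd *v l))\<^sup>2
     + l \<bullet> (Gd *v F x - \<alpha> *\<^sub>R (Gd *v x - Hs) + L *v z)
     + 1/2 * (l \<bullet> (L *v l))"

(* Classical solutions of the closed-loop dynamics on [0, \<infinity>); the derivative at time 0 is
   the right derivative. *)
definition trajectory ::
  "('n::finite \<Rightarrow> 'p) \<Rightarrow> ('p \<Rightarrow> real^'n \<Rightarrow> real) \<Rightarrow> real^'n^'m \<Rightarrow> ('p::finite \<Rightarrow> real^'m::finite)
   \<Rightarrow> real^'p^'p \<Rightarrow> real
   \<Rightarrow> (real \<Rightarrow> real^'n) \<Rightarrow> (real \<Rightarrow> real^('p \<times> 'm)) \<Rightarrow> (real \<Rightarrow> real^('p \<times> 'm)) \<Rightarrow> bool" where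
  "trajectory own J G h A \<alpha> x z l \<longleftrightarrow>
     (let F = pseudo_gradient own J; Gd = block_diag own G; Hs = col_stack h;
          L = kron_id (laplacian A)
      in \<forall>t\<ge>0.
        (x has_vector_derivative (- F (x t) - transpose Gd *v l t)) (at t within {0..}) \<and>
        (z has_vector_derivative (L *v l t)) (at t within {0..}) \<and>
        is_arg_min (multiplier_cost Gd Hs L \<alpha> F (x t) (z t)) (\<lambda>v. 0 \<le> v) (l t))"

end

theory Submission
  imports Defs
begin

text \<open>The multiplier program is strictly convex: \<open>G\<^sub>d G\<^sub>d\<^sup>T + L\<close> is positive definite, because \<open>L\<close>
  vanishes only on consensus vectors, on which \<open>G\<^sub>d\<^sup>T\<close> acts as the injective \<open>G\<^sup>T\<close>.  Hence the minimizer
  is a Lipschitz function of \<open>(x, z)\<close>, the closed loop is a globally Lipschitz differential equation,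
  and the optimality conditions say that \<open>w = - G\<^sub>d x' - \<alpha> (G\<^sub>d x - H\<^sub>s) + L (z + \<lambda>)\<close> is nonnegative and
  complementary to \<open>\<lambda> \<ge> 0\<close>.  Summing the blocks of \<open>w\<close> over the players removes \<open>L\<close> and gives
  \<open>(G x - H)' \<le> - \<alpha> (G x - H)\<close>, which is forward invariance.  Write \<open>\<Delta>\<close> for the difference to an
  equilibrium.  Complementarity gives \<open>\<Delta>\<lambda> \<bullet> \<Delta>w \<le> 0\<close>, so \<open>V = \<alpha>/2 |\<Delta>x|\<^sup>2 + 1/2 |\<Delta>z|\<^sup>2\<close> satisfies
  \<open>V' \<le> - |x'|\<^sup>2 - \<Delta>F \<bullet> x' - \<alpha> \<Delta>F \<bullet> \<Delta>x \<le> - (\<alpha> \<mu> - \<theta>\<^sup>2/4) |\<Delta>x|\<^sup>2\<close>.  As \<open>x\<close> is Lipschitz in time,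
  \<open>\<Delta>x\<close> tends to zero.\<close>

subsection \<open>Strongly monotone variational inequalities\<close>

text \<open>Each inequality is tested at the other solution; after adding them, strong monotonicity
  of \<open>F\<close> bounds the distance by the discrepancy of the two maps at \<open>y\<close>.
  With \<open>F' = F\<close> this gives uniqueness, and with maps taken at different states it gives
  Lipschitz dependence of the multiplier.\<close>

lemma solves_VI_stability:
  assumes mono: "strongly_monotone \<mu> F" and "\<mu> > 0"
    and x: "solves_VI S F x" and y: "solves_VI S F' y"
  shows "\<mu> * norm (x - y) \<le> norm (F y - F' y)"
proof -
  have "(y - x) \<bullet> F x \<ge> 0" "(x - y) \<bullet> F' y \<ge> 0"
    using x y by (auto simp: solves_VI_def)
  then have "(F x - F y) \<bullet> (x - y) \<le> (x - y) \<bullet> (F' y - F y)"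
    by (simp add: inner_diff_left inner_diff_right inner_commute)
  also have "\<dots> \<le> norm (x - y) * norm (F y - F' y)"
    using norm_cauchy_schwarz[of "x - y" "F' y - F y"] by (simp add: norm_minus_commute)
  finally have "\<mu> * (norm (x - y))\<^sup>2 \<le> norm (x - y) * norm (F y - F' y)"
    using mono unfolding strongly_monotone_def by (meson order_trans)
  then show ?thesis
    by (cases "norm (x - y) = 0") (auto simp: power2_eq_square mult.left_commute)
qed

lemma solves_VI_unique:
  assumes "strongly_monotone \<mu> F" "\<mu> > 0" "solves_VI S F x" "solves_VI S F y"
  shows "x = y"
  using solves_VI_stability[OF assms] \<open>\<mu> > 0\<close> by (simp add: mult_le_0_iff)

text \<open>Solutions are fixed points of a projected step from \<open>x\<close> to the point of
  \<open>S\<close> closest to \<open>x - \<gamma> *\<^sub>R F x\<close>. Projection is nonexpansive,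
  and for suitable \<open>\<gamma>\<close> strong monotonicity makes the step a contraction.\<close>

lemma solves_VI_exists:
  fixes F :: "'a::euclidean_space \<Rightarrow> 'a"
  assumes mono: "strongly_monotone \<mu> F" and "\<mu> > 0"
    and lip: "\<theta>-lipschitz_on UNIV F"
    and S: "convex S" "closed S" "S \<noteq> {}"
  obtains x where "solves_VI S F x"
proof -
  \<comment> \<open>An enlarged Lipschitz constant, positive and at least \<open>\<mu>\<close>,
    which keeps \<open>q\<close> below in \<open>[0, 1)\<close>.\<close>
  define K where "K = \<theta> + \<mu>"
  have "\<theta> \<ge> 0" using lip by (rule lipschitz_on_nonneg)
  then have K: "K \<ge> \<mu>" "K > 0" using \<open>\<mu> > 0\<close> by (auto simp: K_def)
  have lipK: "norm (F x - F y) \<le> K * norm (x - y)" for x y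
    using lipschitz_on_normD[OF lip, of x y] \<open>\<mu> > 0\<close>
    by (simp add: K_def distrib_right add_increasing2)
  \<comment> \<open>The minimizer of the squared contraction factor
    \<open>1 - 2 * \<gamma> * \<mu> + \<gamma>\<^sup>2 * K\<^sup>2\<close>; the minimum is
    \<open>q\<close>.\<close>
  define \<gamma> where "\<gamma> = \<mu> / K\<^sup>2"
  have "\<gamma> > 0" using K \<open>\<mu> > 0\<close> by (simp add: \<gamma>_def)
  define q where "q = 1 - \<mu>\<^sup>2 / K\<^sup>2"
  have q: "0 \<le> q" "q < 1"
    using K \<open>\<mu> > 0\<close> by (auto simp: q_def divide_simps power_mono)
  have q_eq: "q = 1 - 2 * \<gamma> * \<mu> + \<gamma>\<^sup>2 * K\<^sup>2"
    using K by (simp add: q_def \<gamma>_def power2_eq_square field_simps)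
  define T where "T x = closest_point S (x - \<gamma> *\<^sub>R F x)" for x
  have "dist (T x) (T y) \<le> sqrt q * dist x y" for x y
  proof -
    have "(norm (x - y - \<gamma> *\<^sub>R (F x - F y)))\<^sup>2
        = (norm (x - y))\<^sup>2 - 2 * \<gamma> * ((F x - F y) \<bullet> (x - y)) + \<gamma>\<^sup>2 * (norm (F x - F y))\<^sup>2"
      unfolding power2_norm_eq_inner
      by (simp add: inner_diff_left inner_diff_right inner_commute algebra_simps power2_eq_square)
    also have "\<dots> \<le> (norm (x - y))\<^sup>2 - 2 * \<gamma> * (\<mu> * (norm (x - y))\<^sup>2)
        + \<gamma>\<^sup>2 * (K * norm (x - y))\<^sup>2"
      using mono \<open>\<gamma> > 0\<close> lipK[of x y]
      by (intro add_mono diff_mono mult_left_mono power_mono)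
         (auto simp: strongly_monotone_def)
    also have "\<dots> = (sqrt q * norm (x - y))\<^sup>2"
      using q by (simp add: power_mult_distrib q_eq algebra_simps)
    finally have "norm (x - y - \<gamma> *\<^sub>R (F x - F y)) \<le> sqrt q * norm (x - y)"
      using q by (simp add: power2_le_iff_abs_le)
    moreover have "dist (T x) (T y) \<le> dist (x - \<gamma> *\<^sub>R F x) (y - \<gamma> *\<^sub>R F y)"
      unfolding T_def by (rule closest_point_lipschitz[OF S])
    ultimately show ?thesis
      by (simp add: dist_norm algebra_simps)
  qed
  then have "\<exists>!x. T x = x"
    using q by (intro banach_fix_type[of "sqrt q"]) auto
  then obtain x where x: "T x = x" by auto
  have "x \<in> S"
    using closest_point_in_set[OF S(2,3)] x unfolding T_def by metis
  moreover have "(y - x) \<bullet> F x \<ge> 0" if "y \<in> S" for y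
  proof -
    have "(x - \<gamma> *\<^sub>R F x - x) \<bullet> (y - x) \<le> 0"
      using closest_point_dot[OF S(1,2) that, of "x - \<gamma> *\<^sub>R F x"] x by (simp add: T_def)
    then show ?thesis
      using \<open>\<gamma> > 0\<close> by (simp add: zero_le_mult_iff inner_commute)
  qed
  ultimately show thesis
    using that by (auto simp: solves_VI_def)
qed

subsection \<open>Global solutions of Lipschitz differential equations\<close>

text \<open>The exponential bound integrates to at most \<open>C / K * exp (K * t)\<close>, and the
  weight cancels the growth. This yields both the boundedness of the Picard images and the
  contraction factor.\<close>

lemma exp_weighted_integral_bound:
  fixes g :: "real \<Rightarrow> 'a::banach"
  assumes "K > 0" "C \<ge> 0" "t \<ge> 0" and cont: "continuous_on {0..t} g"
    and bound: "\<And>s. s \<in> {0..t} \<Longrightarrow> norm (g s) \<le> C * exp (K * s)"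
  shows "norm (exp (- K * t) *\<^sub>R integral {0..t} g) \<le> C / K"
proof -
  have *: "((\<lambda>s. C * exp (K * s)) has_integral (C / K * exp (K * t) - C / K * exp (K * 0))) {0..t}"
    using assms
    by (intro fundamental_theorem_of_calculus)
       (auto intro!: derivative_eq_intros simp flip: has_real_derivative_iff_has_vector_derivative)
  have "norm (integral {0..t} g) \<le> integral {0..t} (\<lambda>s. C * exp (K * s))"
    using * bound cont
    by (intro integral_norm_bound_integral integrable_continuous_real) (auto intro!: continuous_intros)
  also have "\<dots> = C / K * exp (K * t) - C / K * exp (K * 0)"
    using * by (rule integral_unique)
  also have "\<dots> \<le> C / K * exp (K * t)" using assms by simp
  finally have "exp (- K * t) * norm (integral {0..t} g) \<le> exp (- K * t) * (C / K * exp (K * t))"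
    by (intro mult_left_mono) auto
  also have "\<dots> = C / K" by (simp add: exp_minus)
  finally show ?thesis by simp
qed

lemma integral_has_vector_derivative_half_line:
  fixes g :: "real \<Rightarrow> 'a::banach"
  assumes "continuous_on UNIV g" "t \<ge> 0"
  shows "((\<lambda>u. integral {0..u} g) has_vector_derivative g t) (at t within {0..})"
proof -
  have "((\<lambda>u. integral {0..u} g) has_vector_derivative g t) (at t within {0..t+1})"
    using assms by (intro integral_has_vector_derivative) (auto intro: continuous_on_subset)
  moreover have "at t within {0..t+1} = at t within {0..}"
    by (rule at_within_nhd[of t "{..<t+1}"]) auto
  ultimately show ?thesis by simp
qed

text \<open>Bounded continuous functions are taken on the whole line; for \<open>u \<le> 0\<close>
  the integral is simply zero.\<close>

lemma continuous_on_integral_half_line: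
  fixes g :: "real \<Rightarrow> 'a::banach"
  assumes "continuous_on UNIV g"
  shows "continuous_on UNIV (\<lambda>u. integral {0..u} g)"
proof -
  have "continuous_on {0..} (\<lambda>u. integral {0..u} g)"
    using integral_has_vector_derivative_half_line[OF assms]
    by (auto simp: continuous_on_eq_continuous_within intro: has_vector_derivative_continuous)
  moreover have "integral {0..u} g = 0" if "u \<le> 0" for u :: real
    using that by (cases "u = 0") auto
  then have "continuous_on {..0::real} (\<lambda>u. integral {0..u} g)"
    by (subst continuous_on_cong[OF refl, where g = "\<lambda>_. 0"]) auto
  moreover have "{..0} \<union> {0::real..} = UNIV" by auto
  ultimately show ?thesis
    by (metis continuous_on_closed_Un closed_atLeast closed_atMost)
qed

text \<open>Weighting the Picard operator by \<open>exp (- K * t)\<close> makes it a contraction on all bounded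
  continuous functions at once, so that no gluing of local solutions is needed.\<close>

theorem lipschitz_ode_global_solution:
  fixes f :: "'a::banach \<Rightarrow> 'a"
  assumes lip: "L-lipschitz_on UNIV f"
  obtains y where "y 0 = y0"
    and "\<And>t. t \<ge> 0 \<Longrightarrow> (y has_vector_derivative f (y t)) (at t within {0..})"
proof -
  have "L \<ge> 0" using lip by (rule lipschitz_on_nonneg)
  \<comment> \<open>Any weight above \<open>L\<close> makes the factor \<open>L / K\<close> less
    than one; adding one also covers \<open>L = 0\<close>.\<close>
  define K where "K = L + 1"
  have K: "K > 0" "0 \<le> L / K" "L / K < 1" using \<open>L \<ge> 0\<close> by (auto simp: K_def)
  have contf: "continuous_on UNIV f" using lip by (rule lipschitz_on_continuous_on)
  \<comment> \<open>The unknown \<open>u\<close> is the rescaled displacement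
    \<open>exp (- K * t) *\<^sub>R (y t - y0)\<close> of the solution \<open>y\<close>, and
    \<open>P\<close> below is the Picard operator in this variable.\<close>
  define v where "v u s = f (y0 + exp (K * s) *\<^sub>R apply_bcontfun u s)"
    for u :: "real \<Rightarrow>\<^sub>C 'a" and s
  define P where "P u t = exp (- K * t) *\<^sub>R integral {0..t} (v u)" for u t
  have v_cont: "continuous_on A (v u)" for u A
    unfolding v_def by (rule continuous_on_compose2[OF contf]) (auto intro!: continuous_intros)
  have P_neg: "P u t = 0" if "t < 0" for u t
    using that by (simp add: P_def)
  have P_cont: "continuous_on UNIV (P u)" for u
    unfolding P_def using continuous_on_integral_half_line[OF v_cont, of u]
    by (intro continuous_intros)
  have P_bcontfun: "P u \<in> bcontfun" for u
  proof (rule bcontfun_normI[OF P_cont])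
    fix t :: real
    \<comment> \<open>Linear growth of \<open>f\<close> around \<open>y0\<close>, with the constant
      term absorbed by \<open>1 \<le> exp (K * s)\<close> for \<open>s \<ge> 0\<close>.\<close>
    define C where "C = norm (f y0) + L * norm u"
    have "C \<ge> 0" using \<open>L \<ge> 0\<close> by (simp add: C_def)
    show "norm (P u t) \<le> C / K"
    proof (cases "t < 0")
      case True
      then show ?thesis using P_neg \<open>C \<ge> 0\<close> K by simp
    next
      case False
      have "norm (v u s) \<le> C * exp (K * s)" if "s \<in> {0..t}" for s
      proof -
        have "norm (v u s) \<le> norm (f y0) + norm (v u s - f y0)"
          using norm_triangle_sub by blast
        also have "norm (v u s - f y0) \<le> L * (exp (K * s) * norm (apply_bcontfun u s))"
          using lipschitz_on_normD[OF lip, of "y0 + exp (K * s) *\<^sub>R apply_bcontfun u s" y0]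
          by (simp add: v_def)
        also have "\<dots> \<le> L * (exp (K * s) * norm u)"
          using \<open>L \<ge> 0\<close> by (intro mult_left_mono norm_bounded) auto
        also have "norm (f y0) \<le> norm (f y0) * exp (K * s)"
          using that K mult_left_mono[of 1 "exp (K * s)" "norm (f y0)"] by simp
        finally show ?thesis by (simp add: C_def algebra_simps)
      qed
      then show ?thesis
        unfolding P_def using False K \<open>C \<ge> 0\<close> v_cont
        by (intro exp_weighted_integral_bound) auto
    qed
  qed
  define \<Phi> where "\<Phi> u = Bcontfun (P u)" for u
  have \<Phi>: "apply_bcontfun (\<Phi> u) = P u" for u
    unfolding \<Phi>_def by (rule Bcontfun_inverse[OF P_bcontfun])
  have "dist (\<Phi> u) (\<Phi> w) \<le> L / K * dist u w" for u w
  proof (rule dist_bound)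
    fix t :: real
    show "dist (apply_bcontfun (\<Phi> u) t) (apply_bcontfun (\<Phi> w) t) \<le> L / K * dist u w"
    proof (cases "t < 0")
      case True
      then show ?thesis using P_neg K \<open>L \<ge> 0\<close> by (simp add: \<Phi>)
    next
      case False
      have "norm (v u s - v w s) \<le> L * dist u w * exp (K * s)" for s
      proof -
        have "norm (v u s - v w s)
            \<le> L * (exp (K * s) * dist (apply_bcontfun u s) (apply_bcontfun w s))"
          using lipschitz_on_normD[OF lip, of "y0 + exp (K * s) *\<^sub>R apply_bcontfun u s"
              "y0 + exp (K * s) *\<^sub>R apply_bcontfun w s"]
          by (simp add: v_def dist_norm flip: scaleR_diff_right)
        also have "\<dots> \<le> L * (exp (K * s) * dist u w)"
          using \<open>L \<ge> 0\<close> by (intro mult_left_mono dist_bounded) auto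
        finally show ?thesis by (simp add: algebra_simps)
      qed
      then have "norm (exp (- K * t) *\<^sub>R integral {0..t} (\<lambda>s. v u s - v w s)) \<le> L * dist u w / K"
        using False K \<open>L \<ge> 0\<close> v_cont
        by (intro exp_weighted_integral_bound continuous_intros) auto
      moreover have "integral {0..t} (\<lambda>s. v u s - v w s) = integral {0..t} (v u) - integral {0..t} (v w)"
        by (intro Henstock_Kurzweil_Integration.integral_diff integrable_continuous_real v_cont)
      ultimately show ?thesis
        by (simp add: \<Phi> P_def dist_norm scaleR_diff_right)
    qed
  qed
  then have "\<exists>!u. \<Phi> u = u"
    using K by (intro banach_fix_type[of "L / K"]) auto
  then obtain u where "\<Phi> u = u" by auto
  then have u: "apply_bcontfun u t = P u t" for t
    using \<Phi>[of u] by simp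
  define y where "y t = y0 + exp (K * t) *\<^sub>R apply_bcontfun u t" for t
  have y_integral: "y = (\<lambda>t. y0 + integral {0..t} (v u))"
    by (rule ext) (simp add: y_def u P_def exp_minus)
  have v_y: "v u t = f (y t)" for t
    by (simp add: v_def y_def)
  show thesis
  proof
    show "y 0 = y0" by (simp add: y_integral)
    fix t :: real assume "t \<ge> 0"
    then have "((\<lambda>t. y0 + integral {0..t} (v u)) has_vector_derivative 0 + v u t) (at t within {0..})"
      by (intro has_vector_derivative_add has_vector_derivative_const
          integral_has_vector_derivative_half_line v_cont)
    then show "(y has_vector_derivative f (y t)) (at t within {0..})"
      by (simp add: v_y flip: y_integral)
  qed
qed

subsection \<open>Convergence from a Lyapunov function\<close>

text \<open>The sign of the derivative matters only at interior times, where the one-sided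
  derivative is an ordinary one.\<close>

lemma nonincreasing_half_line:
  fixes V :: "real \<Rightarrow> real"
  assumes V: "\<And>t. t \<ge> 0 \<Longrightarrow> (V has_real_derivative V' t) (at t within {0..})"
    and ab: "0 \<le> a" "a \<le> b" and nonpos: "\<And>t. a < t \<Longrightarrow> t < b \<Longrightarrow> V' t \<le> 0"
  shows "V b \<le> V a"
proof (rule DERIV_nonpos_imp_decreasing_open[OF \<open>a \<le> b\<close>])
  fix t assume t: "a < t" "t < b"
  have "at t within {0..} = at t"
    using t ab by (intro at_within_interior) (simp add: interior_Ici[of _ "-1"])
  then show "\<exists>y. (V has_real_derivative y) (at t) \<and> y \<le> 0"
    using V[of t] nonpos[of t] t ab by auto
next
  show "continuous_on {a..b} V"
    using ab by (auto simp: continuous_on_eq_continuous_within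
        intro!: DERIV_isCont DERIV_continuous[OF DERIV_subset[OF V]])
qed

lemma lipschitz_half_line:
  fixes e :: "real \<Rightarrow> 'a::real_normed_vector"
  assumes e: "\<And>t. t \<ge> 0 \<Longrightarrow> (e has_vector_derivative e' t) (at t within {0..})"
    and bound: "\<And>t. t \<ge> 0 \<Longrightarrow> norm (e' t) \<le> B"
  shows "B-lipschitz_on {0..} e"
proof (rule lipschitz_onI)
  show "0 \<le> B" using bound[of 0] norm_ge_zero[of "e' 0"] by linarith
  fix s t :: real assume "s \<in> {0..}" "t \<in> {0..}"
  then show "dist (e s) (e t) \<le> B * dist s t"
    unfolding dist_norm
    using e bound
    by (intro differentiable_bound[of "{0..}" e "\<lambda>t h. h *\<^sub>R e' t"])
       (auto simp: has_vector_derivative_def mult.commute[of B] intro!: onorm_le mult_left_mono)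
qed

text \<open>A Barbalat argument: whenever \<open>e\<close> has norm at least
  \<open>\<epsilon>\<close>, its Lipschitz bound keeps it above \<open>\<epsilon> / 2\<close> for a
  fixed time, so \<open>V\<close> drops by a fixed amount. Once \<open>V\<close> is that close to
  its infimum, this cannot happen any more.\<close>

lemma lyapunov_tendsto_zero:
  fixes V :: "real \<Rightarrow> real" and e :: "real \<Rightarrow> 'a::real_normed_vector"
  assumes V: "\<And>t. t \<ge> 0 \<Longrightarrow> (V has_real_derivative V' t) (at t within {0..})"
    and decay: "\<And>t. t \<ge> 0 \<Longrightarrow> V' t \<le> - c * (norm (e t))\<^sup>2" and "c > 0"
    and nonneg: "\<And>t. t \<ge> 0 \<Longrightarrow> V t \<ge> 0"
    and lip: "B-lipschitz_on {0..} e"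
  shows "(e \<longlongrightarrow> 0) at_top"
proof (rule tendstoI)
  fix \<epsilon> :: real assume "\<epsilon> > 0"
  have "B \<ge> 0" using lip by (rule lipschitz_on_nonneg)
  \<comment> \<open>Within time \<open>\<delta>\<close> the vector \<open>e\<close> moves by at most
    \<open>\<epsilon> / 2\<close>; \<open>B + 1\<close> avoids a division by zero.\<close>
  define \<delta> where "\<delta> = \<epsilon> / (2 * (B + 1))"
  have "\<delta> > 0" using \<open>\<epsilon> > 0\<close> \<open>B \<ge> 0\<close> by (simp add: \<delta>_def)
  define \<eta> where "\<eta> = c * (\<epsilon> / 2)\<^sup>2 * \<delta>"
  have "\<eta> > 0" using \<open>\<epsilon> > 0\<close> \<open>\<delta> > 0\<close> \<open>c > 0\<close> by (simp add: \<eta>_def)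
  have V_dec: "V b \<le> V a" if "0 \<le> a" "a \<le> b" for a b
    using that \<open>c > 0\<close>
    by (intro nonincreasing_half_line[OF V]) (auto intro!: order_trans[OF decay])
  have drop: "V (t + \<delta>) \<le> V t - \<eta>" if "t \<ge> 0" "norm (e t) \<ge> \<epsilon>" for t
  proof -
    have large: "norm (e s) \<ge> \<epsilon> / 2" if s: "t \<le> s" "s \<le> t + \<delta>" for s
    proof -
      have "norm (e t - e s) \<le> B * (s - t)"
        using lipschitz_on_normD[OF lip, of t s] s \<open>t \<ge> 0\<close> by simp
      also have "\<dots> \<le> (B + 1) * \<delta>"
        using s \<open>B \<ge> 0\<close> \<open>\<delta> > 0\<close> by (intro mult_mono) auto
      also have "\<dots> = \<epsilon> / 2"
        using \<open>B \<ge> 0\<close> by (simp add: \<delta>_def field_simps)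
      finally show ?thesis
        using norm_triangle_ineq2[of "e t" "e s"] \<open>norm (e t) \<ge> \<epsilon>\<close> by simp
    qed
    \<comment> \<open>Adding a linear function with the guaranteed decay rate as slope replaces an
      integration of \<open>V'\<close>.\<close>
    have "V (t + \<delta>) + c * (\<epsilon> / 2)\<^sup>2 * (t + \<delta>) \<le> V t + c * (\<epsilon> / 2)\<^sup>2 * t"
    proof (rule nonincreasing_half_line[where V = "\<lambda>s. V s + c * (\<epsilon> / 2)\<^sup>2 * s"
          and V' = "\<lambda>s. V' s + c * (\<epsilon> / 2)\<^sup>2"])
      fix s assume s: "t < s" "s < t + \<delta>"
      have "(\<epsilon> / 2)\<^sup>2 \<le> (norm (e s))\<^sup>2"
        using large[of s] s \<open>\<epsilon> > 0\<close> by (intro power_mono) auto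
      then have "c * (\<epsilon> / 2)\<^sup>2 \<le> c * (norm (e s))\<^sup>2"
        using \<open>c > 0\<close> by (intro mult_left_mono) auto
      then show "V' s + c * (\<epsilon> / 2)\<^sup>2 \<le> 0"
        using decay[of s] s \<open>t \<ge> 0\<close> by auto
    qed (use \<open>t \<ge> 0\<close> \<open>\<delta> > 0\<close> in \<open>auto intro!: derivative_eq_intros V\<close>)
    then show ?thesis by (simp add: \<eta>_def algebra_simps)
  qed
  define m where "m = Inf (V ` {0..})"
  have bdd: "bdd_below (V ` {0..})"
    using nonneg by (auto intro!: bdd_belowI[of _ 0])
  have "\<exists>v \<in> V ` {0..}. v < m + \<eta>"
    using cInf_lessD[of "V ` {0..}" "m + \<eta>"] \<open>\<eta> > 0\<close> by (auto simp: m_def)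
  then obtain T where T: "T \<ge> 0" "V T < m + \<eta>" by auto
  have "dist (e t) 0 < \<epsilon>" if "t \<ge> T" for t
  proof (rule ccontr)
    assume "\<not> dist (e t) 0 < \<epsilon>"
    then have "V (t + \<delta>) \<le> V t - \<eta>" using drop that T by simp
    also have "V t \<le> V T" using V_dec that T by simp
    finally have "V (t + \<delta>) < m" using T by simp
    moreover have "m \<le> V (t + \<delta>)"
      unfolding m_def using that T \<open>\<delta> > 0\<close> by (intro cInf_lower bdd imageI) auto
    ultimately show False by simp
  qed
  then show "\<forall>\<^sub>F t in at_top. dist (e t) 0 < \<epsilon>"
    by (auto simp: eventually_at_top_linorder)
qed

subsection \<open>Matrices\<close>

lemma inner_matrix_vector_transpose:
  fixes M :: "real^'n^'m"
  shows "(M *v x) \<bullet> y = x \<bullet> (transpose M *v y)"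
  by (metis dot_lmul_matrix inner_commute transpose_matrix_vector)

lemma inner_transpose_matrix_vector:
  fixes M :: "real^'n^'m"
  shows "(transpose M *v x) \<bullet> y = x \<bullet> (M *v y)"
  by (metis inner_matrix_vector_transpose transpose_transpose)

lemma matrix_vector_mult_lipschitz:
  fixes M :: "real^'n^'m"
  obtains B where "B-lipschitz_on UNIV ((*v) M)"
proof -
  obtain B where B: "B > 0" "\<And>x. norm (M *v x) \<le> norm x * B"
    using bounded_linear.pos_bounded[OF matrix_vector_mul_bounded_linear[of M]] by auto
  have "B-lipschitz_on UNIV ((*v) M)"
    using B by (intro lipschitz_onI)
      (auto simp: dist_norm mult.commute simp flip: matrix_vector_mult_diff_distrib)
  then show thesis by (rule that)
qed

text \<open>The component \<open>w\<close> of \<open>b\<close> orthogonal to the range lies in the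
  kernel of the transpose, so it is orthogonal to \<open>b\<close> and hence zero.\<close>

lemma matrix_range_exists:
  fixes M :: "real^'n^'m"
  assumes "\<And>v. transpose M *v v = 0 \<Longrightarrow> v \<bullet> b = 0"
  obtains u where "M *v u = b"
proof -
  have range: "span (range ((*v) M)) = range ((*v) M)"
    by (intro span_eq_iff[THEN iffD2] linear_subspace_image) auto
  obtain y w where y: "y \<in> span (range ((*v) M))"
    and w: "\<And>v. v \<in> span (range ((*v) M)) \<Longrightarrow> orthogonal w v" and b: "b = y + w"
    using orthogonal_subspace_decomp_exists[of "range ((*v) M)" b] by metis
  have w_range: "w \<bullet> (M *v u) = 0" for u
    using w[of "M *v u"] range by (auto simp: orthogonal_def)
  have "(transpose M *v w) \<bullet> (transpose M *v w) = 0"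
    unfolding inner_transpose_matrix_vector by (rule w_range)
  then have "w \<bullet> b = 0" using assms by simp
  moreover have "w \<bullet> y = 0" using w[OF y] by (simp add: orthogonal_def)
  ultimately have "w = 0" by (simp add: b inner_add_right)
  then show thesis using that y range b by auto
qed

text \<open>The constant is the minimum of the form over the compact unit sphere; homogeneity
  extends the bound to all vectors.\<close>

lemma positive_definite_imp_coercive:
  fixes f :: "'a::euclidean_space \<Rightarrow> 'a"
  assumes "linear f" and pos: "\<And>x. x \<noteq> 0 \<Longrightarrow> x \<bullet> f x > 0"
  obtains q where "q > 0" "\<And>x. q * (norm x)\<^sup>2 \<le> x \<bullet> f x"
proof -
  have "continuous_on (sphere 0 1) (\<lambda>x. x \<bullet> f x)"
    by (intro continuous_intros linear_continuous_on linear_linear[THEN iffD2] \<open>linear f\<close>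
        linear_conv_bounded_linear[THEN iffD1])
  then obtain u :: 'a where u: "u \<in> sphere 0 1" "\<And>x. x \<in> sphere 0 1 \<Longrightarrow> u \<bullet> f u \<le> x \<bullet> f x"
    using continuous_attains_inf[of "sphere (0::'a) 1" "\<lambda>x. x \<bullet> f x"] by auto
  have "(u \<bullet> f u) * (norm x)\<^sup>2 \<le> x \<bullet> f x" for x
  proof (cases "x = 0")
    case False
    define d where "d = x /\<^sub>R norm x"
    have x: "x = norm x *\<^sub>R d" and "d \<in> sphere 0 1"
      using False by (simp_all add: d_def)
    have "f x = norm x *\<^sub>R f d"
      using linear_cmul[OF \<open>linear f\<close>, of "norm x" d] x by metis
    then have "x \<bullet> f x = (norm x *\<^sub>R d) \<bullet> (norm x *\<^sub>R f d)"
      using x by metis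
    then have "x \<bullet> f x = (norm x)\<^sup>2 * (d \<bullet> f d)"
      by (simp add: power2_eq_square)
    then show ?thesis
      using u(2)[OF \<open>d \<in> sphere 0 1\<close>] by (simp add: mult.commute[of _ "(norm x)\<^sup>2"] mult_left_mono)
  qed (simp add: linear_0[OF \<open>linear f\<close>])
  moreover have "u \<bullet> f u > 0" using pos[of u] u(1) by (cases "u = 0") auto
  ultimately show thesis using that by blast
qed

section \<open>The graph Laplacian acting on stacked vectors\<close>

lemma sum_UNIV_prod:
  "(\<Sum>ir\<in>UNIV. f ir) = (\<Sum>i\<in>UNIV. \<Sum>r\<in>UNIV. f (i, r))"
  by (simp add: sum.cartesian_product)

text \<open>The diagonal degree is a row sum of \<open>A\<close>, so it distributes over the
  neighbours and leaves weighted differences.\<close>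

lemma laplacian_vector_nth:
  fixes A :: "real^'p::finite^'p" and v :: "real^('p \<times> 'm::finite)"
  shows "(kron_id (laplacian A) *v v) $ (i, r) = (\<Sum>j\<in>UNIV. A $ i $ j * (v $ (i, r) - v $ (j, r)))"
proof -
  have "(kron_id (laplacian A) *v v) $ (i, r)
      = (\<Sum>j\<in>UNIV. \<Sum>s\<in>UNIV. if r = s then laplacian A $ i $ j * v $ (j, s) else 0)"
    unfolding matrix_vector_mult_def kron_id_def sum_UNIV_prod
    by (simp add: if_distrib[of "\<lambda>c. c * _"] cong: if_cong)
  also have "\<dots> = (\<Sum>j\<in>UNIV. laplacian A $ i $ j * v $ (j, r))"
    by simp
  also have "\<dots> = (\<Sum>j\<in>UNIV. (if i = j then (A *v 1) $ i * v $ (j, r) else 0) - A $ i $ j * v $ (j, r))"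
    by (intro sum.cong) (auto simp: laplacian_def left_diff_distrib)
  also have "\<dots> = (A *v 1) $ i * v $ (i, r) - (\<Sum>j\<in>UNIV. A $ i $ j * v $ (j, r))"
    by (simp add: sum_subtractf)
  also have "\<dots> = (\<Sum>j\<in>UNIV. A $ i $ j * (v $ (i, r) - v $ (j, r)))"
    by (simp add: matrix_vector_mult_def sum_distrib_right right_diff_distrib sum_subtractf)
  finally show ?thesis .
qed

lemma symmetric_matrix_nth:
  assumes "transpose A = A"
  shows "A $ i $ j = A $ j $ i"
  using arg_cong[OF assms, of "\<lambda>B. B $ j $ i"] by (simp add: transpose_def)

lemma transpose_laplacian:
  assumes "transpose A = A"
  shows "transpose (kron_id (laplacian A)) = kron_id (laplacian A)"
  by (auto simp: vec_eq_iff transpose_def kron_id_def laplacian_def symmetric_matrix_nth[OF assms])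

text \<open>Exchanging \<open>i\<close> and \<open>j\<close> turns the double sum into its own
  negative.\<close>

lemma laplacian_sum_blocks:
  fixes v :: "real^('p::finite \<times> 'm::finite)"
  assumes "transpose A = A"
  shows "(\<Sum>i\<in>UNIV. (kron_id (laplacian A) *v v) $ (i, r)) = 0"
proof -
  let ?S = "\<Sum>i\<in>UNIV. \<Sum>j\<in>UNIV. A $ i $ j * (v $ (i, r) - v $ (j, r))"
  note sym = symmetric_matrix_nth[OF assms]
  have "?S = (\<Sum>i\<in>UNIV. \<Sum>j\<in>UNIV. A $ j $ i * (v $ (j, r) - v $ (i, r)))"
    by (rule sum.swap)
  also have "\<dots> = - ?S"
    unfolding sum_negf[symmetric] by (intro sum.cong refl) (simp add: sym algebra_simps)
  finally show ?thesis by (simp add: laplacian_vector_nth)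
qed

text \<open>Averaging the double sum with its copy under the exchange of \<open>i\<close> and
  \<open>j\<close> produces the squares.\<close>

lemma laplacian_quadratic_form:
  fixes v :: "real^('p::finite \<times> 'm::finite)"
  assumes "transpose A = A"
  shows "v \<bullet> (kron_id (laplacian A) *v v)
    = (\<Sum>r\<in>UNIV. \<Sum>i\<in>UNIV. \<Sum>j\<in>UNIV. A $ i $ j * (v $ (i, r) - v $ (j, r))\<^sup>2) / 2"
proof -
  note sym = symmetric_matrix_nth[OF assms]
  define S where "S r = (\<Sum>i\<in>UNIV. \<Sum>j\<in>UNIV. v $ (i, r) * (A $ i $ j * (v $ (i, r) - v $ (j, r))))"
    for r
  have two_S: "2 * S r = (\<Sum>i\<in>UNIV. \<Sum>j\<in>UNIV. A $ i $ j * (v $ (i, r) - v $ (j, r))\<^sup>2)" for r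
  proof -
    have "S r = (\<Sum>i\<in>UNIV. \<Sum>j\<in>UNIV. v $ (j, r) * (A $ j $ i * (v $ (j, r) - v $ (i, r))))"
      unfolding S_def by (rule sum.swap)
    then have "2 * S r = (\<Sum>i\<in>UNIV. \<Sum>j\<in>UNIV. v $ (i, r) * (A $ i $ j * (v $ (i, r) - v $ (j, r)))
        + v $ (j, r) * (A $ j $ i * (v $ (j, r) - v $ (i, r))))"
      unfolding sum.distrib by (simp add: S_def)
    also have "\<dots> = (\<Sum>i\<in>UNIV. \<Sum>j\<in>UNIV. A $ i $ j * (v $ (i, r) - v $ (j, r))\<^sup>2)"
    proof (intro sum.cong refl)
      fix i j
      show "v $ (i, r) * (A $ i $ j * (v $ (i, r) - v $ (j, r)))
        + v $ (j, r) * (A $ j $ i * (v $ (j, r) - v $ (i, r))) = A $ i $ j * (v $ (i, r) - v $ (j, r))\<^sup>2"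
        unfolding sym[of j i] by (simp add: power2_eq_square algebra_simps)
    qed
    finally show ?thesis .
  qed
  have "v \<bullet> (kron_id (laplacian A) *v v) = (\<Sum>r\<in>UNIV. S r)"
    unfolding S_def inner_vec_def sum_UNIV_prod laplacian_vector_nth
    by (subst sum.swap) (simp add: sum_distrib_left)
  then show ?thesis
    unfolding two_S[symmetric] by (simp flip: sum_distrib_left)
qed

lemma laplacian_nonneg:
  assumes "weighted_graph A"
  shows "v \<bullet> (kron_id (laplacian A) *v v) \<ge> 0"
  using assms by (auto simp: weighted_graph_def laplacian_quadratic_form intro!: sum_nonneg)

text \<open>All squares in the quadratic form vanish, so the blocks agree along edges and, by
  connectedness, everywhere.\<close>

lemma laplacian_kernel:
  fixes v :: "real^('p::finite \<times> 'm::finite)"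
  assumes graph: "weighted_graph A" and "connected_graph A"
    and zero: "v \<bullet> (kron_id (laplacian A) *v v) = 0"
  obtains a where "v = col_stack (\<lambda>_. a)"
proof -
  have A: "A $ i $ j \<ge> 0" for i j using graph by (simp add: weighted_graph_def)
  have "(\<Sum>r\<in>UNIV. \<Sum>i\<in>UNIV. \<Sum>j\<in>UNIV. A $ i $ j * (v $ (i, r) - v $ (j, r))\<^sup>2) = 0"
    using graph zero by (simp add: weighted_graph_def laplacian_quadratic_form)
  then have *: "A $ i $ j * (v $ (i, r) - v $ (j, r))\<^sup>2 = 0" for i j r
    by (simp add: sum_nonneg_eq_0_iff sum_nonneg A)
  have edge: "v $ (i, r) = v $ (j, r)" if "A $ i $ j > 0" for i j r
    using *[of i j r] that by simp
  have "v $ (i, r) = v $ (j, r)" for i j r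
  proof -
    have "(i, j) \<in> {(a, b). A $ a $ b > 0}\<^sup>*"
      using \<open>connected_graph A\<close> by (simp add: connected_graph_def)
    then show ?thesis by (induction rule: rtrancl_induct) (auto dest: edge)
  qed
  \<comment> \<open>All blocks agree, so that of the arbitrary player \<open>undefined\<close>
    represents them.\<close>
  then have "v = col_stack (\<lambda>_. \<chi> r. v $ (undefined, r))"
    by (auto simp: vec_eq_iff col_stack_def)
  then show thesis by (rule that)
qed

lemma laplacian_col_stack:
  "kron_id (laplacian A) *v col_stack (\<lambda>_. a) = 0"
  by (simp add: vec_eq_iff split_paired_all laplacian_vector_nth) (simp add: col_stack_def)

text \<open>By symmetry the range is the orthogonal complement of the kernel, and orthogonality to
  every consensus vector means a zero block sum.\<close>

lemma laplacian_range:
  fixes b :: "real^('p::finite \<times> 'm::finite)"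
  assumes graph: "weighted_graph A" and conn: "connected_graph A"
    and zero_sum: "\<And>r. (\<Sum>i\<in>UNIV. b $ (i, r)) = 0"
  obtains z where "kron_id (laplacian A) *v z = b"
proof (rule matrix_range_exists)
  fix v :: "real^('p \<times> 'm)"
  assume "transpose (kron_id (laplacian A)) *v v = 0"
  then have "kron_id (laplacian A) *v v = 0"
    using graph by (simp add: weighted_graph_def transpose_laplacian del: transpose_matrix_vector)
  then obtain a where v: "v = col_stack (\<lambda>_. a)"
    using laplacian_kernel[OF graph conn, of v] by auto
  have "v \<bullet> b = (\<Sum>r\<in>UNIV. \<Sum>i\<in>UNIV. a $ r * b $ (i, r))"
    unfolding inner_vec_def sum_UNIV_prod by (subst sum.swap) (simp add: v col_stack_def)
  then show "v \<bullet> b = 0"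
    by (simp add: zero_sum flip: sum_distrib_left)
qed (rule that)

section \<open>The block-diagonal constraint matrix\<close>

lemma transpose_block_diag_vector_nth:
  fixes G :: "real^'n::finite^'m::finite" and own :: "'n \<Rightarrow> 'p::finite"
  shows "(transpose (block_diag own G) *v l) $ k = (\<Sum>r\<in>UNIV. G $ r $ k * l $ (own k, r))"
proof -
  have "(transpose (block_diag own G) *v l) $ k
      = (\<Sum>r\<in>UNIV. \<Sum>i\<in>UNIV. if own k = i then G $ r $ k * l $ (i, r) else 0)"
    unfolding matrix_vector_mult_def transpose_def block_diag_def sum_UNIV_prod
    by (subst sum.swap) (auto intro!: sum.cong)
  then show ?thesis by simp
qed

lemma transpose_block_diag_col_stack:
  "transpose (block_diag own G) *v col_stack (\<lambda>_. a) = transpose G *v a"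
  by (simp add: vec_eq_iff transpose_block_diag_vector_nth del: transpose_matrix_vector)
     (simp add: col_stack_def matrix_vector_mult_def transpose_def del: transpose_matrix_vector)

text \<open>Each coordinate belongs to exactly one player, so summing the blocks recovers the
  coupled constraint.\<close>

lemma block_diag_sum_blocks:
  fixes G :: "real^'n::finite^'m::finite" and own :: "'n \<Rightarrow> 'p::finite"
  shows "(\<Sum>i\<in>UNIV. (block_diag own G *v x) $ (i, r)) = (G *v x) $ r"
proof -
  have "(\<Sum>i\<in>UNIV. (block_diag own G *v x) $ (i, r))
      = (\<Sum>k\<in>UNIV. \<Sum>i\<in>UNIV. if own k = i then G $ r $ k * x $ k else 0)"
    unfolding matrix_vector_mult_def block_diag_def
    by (subst sum.swap) (auto intro!: sum.cong)
  then show ?thesis by (simp add: matrix_vector_mult_def)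
qed

lemma col_stack_sum_blocks:
  "(\<Sum>i\<in>UNIV. col_stack h $ (i, r)) = (\<Sum>i\<in>UNIV. h i) $ r"
  by (simp add: col_stack_def)

subsection \<open>The quadratic program for the multipliers\<close>

text \<open>For symmetric \<open>L\<close> this is the gradient of \<open>multiplier_cost\<close>
  with respect to \<open>l\<close>.\<close>

definition multiplier_residual ::
  "real^'n^('p::finite \<times> 'm::finite) \<Rightarrow> real^('p \<times> 'm) \<Rightarrow> real^('p \<times> 'm)^('p \<times> 'm) \<Rightarrow> real
   \<Rightarrow> (real^'n \<Rightarrow> real^'n) \<Rightarrow> real^'n \<Rightarrow> real^('p \<times> 'm) \<Rightarrow> real^('p \<times> 'm) \<Rightarrow> real^('p \<times> 'm)" where
  "multiplier_residual Gd Hs L \<alpha> F x z l =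
     Gd *v (transpose Gd *v l) + L *v l + (Gd *v F x - \<alpha> *\<^sub>R (Gd *v x - Hs) + L *v z)"

text \<open>The exact second-order Taylor expansion in \<open>l\<close>; symmetry of
  \<open>L\<close> merges the two cross terms.\<close>

lemma multiplier_cost_expand:
  assumes "transpose L = L"
  shows "multiplier_cost Gd Hs L \<alpha> F x z (l + d) = multiplier_cost Gd Hs L \<alpha> F x z l
    + d \<bullet> multiplier_residual Gd Hs L \<alpha> F x z l
    + ((norm (transpose Gd *v d))\<^sup>2 + d \<bullet> (L *v d)) / 2"
proof -
  have "l \<bullet> (L *v d) = d \<bullet> (L *v l)"
    using inner_matrix_vector_transpose[of L d l] assms by (simp add: inner_commute)
  moreover have "(transpose Gd *v l) \<bullet> (transpose Gd *v d) = d \<bullet> (Gd *v (transpose Gd *v l))"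
    by (metis inner_commute inner_transpose_matrix_vector)
  moreover obtain c where "Gd *v F x - \<alpha> *\<^sub>R (Gd *v x - Hs) + L *v z = c" by simp
  ultimately show ?thesis
    unfolding multiplier_cost_def multiplier_residual_def power2_norm_eq_inner
      matrix_vector_right_distrib
    using inner_commute[of "transpose Gd *v d" "transpose Gd *v l"] inner_commute[of c]
    by (simp add: inner_add_left inner_add_right field_simps del: transpose_matrix_vector)
qed

lemma nonneg_if_perturbed_nonneg:
  fixes a b :: real
  assumes "\<And>s. 0 < s \<Longrightarrow> s \<le> 1 \<Longrightarrow> 0 \<le> s * a + s\<^sup>2 * b"
  shows "0 \<le> a"
proof -
  have "((\<lambda>s. a + s * b) \<longlongrightarrow> a + 0 * b) (at_right 0)"
    by (intro tendsto_intros)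
  moreover have "\<forall>\<^sub>F s in at_right 0. 0 \<le> a + s * b"
  proof (rule eventually_at_rightI)
    fix s :: real assume s: "s \<in> {0<..<1}"
    then have "0 \<le> s * (a + s * b)"
      using assms[of s] by (simp add: power2_eq_square algebra_simps)
    then show "0 \<le> a + s * b" using s by (simp add: zero_le_mult_iff)
  qed simp
  ultimately show ?thesis
    by (metis tendsto_lowerbound mult_zero_left add.right_neutral trivial_limit_at_right_real)
qed

text \<open>A minimizer is tested along segments in the orthant, with the step length tending to
  zero. Conversely, the second-order term of the expansion is nonnegative. The variational form
  gives access to the stability estimate.\<close>

lemma multiplier_arg_min_iff_VI:
  assumes sym: "transpose L = L" and psd: "\<And>v. v \<bullet> (L *v v) \<ge> 0"
  shows "is_arg_min (multiplier_cost Gd Hs L \<alpha> F x z) (\<lambda>v. 0 \<le> v) l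
    \<longleftrightarrow> solves_VI {v. 0 \<le> v} (multiplier_residual Gd Hs L \<alpha> F x z) l"
    (is "?min \<longleftrightarrow> ?VI")
proof
  assume ?min
  then have "0 \<le> l" and min: "\<And>v. 0 \<le> v \<Longrightarrow>
      multiplier_cost Gd Hs L \<alpha> F x z l \<le> multiplier_cost Gd Hs L \<alpha> F x z v"
    by (auto simp: is_arg_min_linorder)
  moreover have "(v - l) \<bullet> multiplier_residual Gd Hs L \<alpha> F x z l \<ge> 0" if "0 \<le> v" for v
  proof (rule nonneg_if_perturbed_nonneg)
    fix s :: real assume s: "0 < s" "s \<le> 1"
    have "l + s *\<^sub>R (v - l) = (1 - s) *\<^sub>R l + s *\<^sub>R v" by (simp add: algebra_simps)
    also have "\<dots> \<ge> 0" using s \<open>0 \<le> l\<close> \<open>0 \<le> v\<close> by (simp add: less_eq_vec_def)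
    finally have "multiplier_cost Gd Hs L \<alpha> F x z l
        \<le> multiplier_cost Gd Hs L \<alpha> F x z (l + s *\<^sub>R (v - l))" by (rule min)
    then show "0 \<le> s * ((v - l) \<bullet> multiplier_residual Gd Hs L \<alpha> F x z l)
        + s\<^sup>2 * (((norm (transpose Gd *v (v - l)))\<^sup>2 + (v - l) \<bullet> (L *v (v - l))) / 2)"
      unfolding multiplier_cost_expand[OF sym] using s
      by (simp add: matrix_vector_mult_scaleR power_mult_distrib power2_eq_square distrib_left
          add_divide_distrib mult.assoc mult.left_commute del: transpose_matrix_vector)
  qed
  ultimately show ?VI by (simp add: solves_VI_def)
next
  assume VI: ?VI
  have "multiplier_cost Gd Hs L \<alpha> F x z l \<le> multiplier_cost Gd Hs L \<alpha> F x z v" if "0 \<le> v" for v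
    using VI that multiplier_cost_expand[OF sym, of Gd Hs \<alpha> F x z l "v - l"] psd[of "v - l"]
    by (auto simp: solves_VI_def)
  then show ?min using VI by (auto simp: is_arg_min_linorder solves_VI_def)
qed

lemma convex_nonneg_vec: "convex {v :: real^'k. 0 \<le> v}"
  by (auto simp: convex_def less_eq_vec_def)

lemma closed_nonneg_vec: "closed {v :: real^'k. 0 \<le> v}"
  unfolding less_eq_vec_def zero_index by (intro closed_Collect_all closed_Collect_le continuous_intros)

subsection \<open>Variational equilibria\<close>

text \<open>Applying the adjoint of the derivative to \<open>1\<close> gives its Riesz
  representative, and uniqueness makes the definite description in \<open>grad\<close>
  meaningful.\<close>

lemma GDERIV_grad:
  fixes f :: "'a::euclidean_space \<Rightarrow> real"
  assumes "f differentiable (at x)"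
  shows "GDERIV f x :> grad f x"
proof -
  obtain f' where f': "(f has_derivative f') (at x)"
    using assms by (auto simp: differentiable_def)
  then have "f' h = h \<bullet> adjoint f' 1" for h
    using adjoint_works[OF has_derivative_linear[OF f'], of h 1] by simp
  then have "GDERIV f x :> adjoint f' 1"
    using f' unfolding gderiv_def by (metis ext)
  moreover have "D = D'" if "GDERIV f x :> D" "GDERIV f x :> D'" for D D'
    using has_derivative_unique[OF that[unfolded gderiv_def]]
    by (metis vector_eq_rdot inner_commute)
  ultimately show ?thesis
    unfolding grad_def by (metis theI)
qed

text \<open>Restriction to the line from \<open>x\<close> to \<open>y\<close> reduces the claim to
  the tangent bound for real functions.\<close>

lemma convex_on_above_gradient:
  fixes f :: "'a::real_inner \<Rightarrow> real"
  assumes "convex_on UNIV f" and D: "GDERIV f x :> D"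
  shows "f y \<ge> f x + (y - x) \<bullet> D"
proof -
  define \<phi> where "\<phi> s = f (x + s *\<^sub>R (y - x))" for s
  have "convex_on UNIV \<phi>"
  proof (rule convex_onI)
    fix t a b :: real assume t: "0 < t" "t < 1"
    have "x + ((1 - t) *\<^sub>R a + t *\<^sub>R b) *\<^sub>R (y - x)
        = (1 - t) *\<^sub>R (x + a *\<^sub>R (y - x)) + t *\<^sub>R (x + b *\<^sub>R (y - x))"
      by (simp add: algebra_simps)
    then show "\<phi> ((1 - t) *\<^sub>R a + t *\<^sub>R b) \<le> (1 - t) * \<phi> a + t * \<phi> b"
      unfolding \<phi>_def using convex_onD[OF assms(1), of t] t by simp
  qed simp
  moreover have "(\<phi> has_real_derivative ((y - x) \<bullet> D)) (at 0)"
  proof -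
    have line: "((\<lambda>s. x + s *\<^sub>R (y - x)) has_derivative (\<lambda>s. s *\<^sub>R (y - x))) (at 0)"
      by (auto intro!: derivative_eq_intros)
    have "(f has_derivative (\<lambda>h. h \<bullet> D)) (at (x + 0 *\<^sub>R (y - x)))"
      using D by (simp add: gderiv_def)
    from has_derivative_compose[OF line this]
    show ?thesis
      by (simp add: \<phi>_def[abs_def] has_field_derivative_def mult_commute_abs)
  qed
  ultimately have "\<phi> 1 - \<phi> 0 \<ge> ((y - x) \<bullet> D) * (1 - 0)"
    by (intro convex_on_imp_above_tangent[of UNIV]) auto
  then show ?thesis by (simp add: \<phi>_def)
qed

lemma repl_idem: "repl own i (repl own i y x) x = repl own i y x"
  by (simp add: repl_def vec_eq_iff)

lemma repl_self: "repl own i x x = x"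
  by (simp add: repl_def vec_eq_iff)

text \<open>A feasible unilateral deviation is a test point of the variational inequality. Its
  displacement is supported in block \<open>i\<close>, where the pseudo-gradient is the gradient of
  player \<open>i\<close>, and convexity turns the first-order condition into optimality.\<close>

lemma VI_imp_GNE:
  fixes J :: "'p \<Rightarrow> real^'n::finite \<Rightarrow> real"
  assumes C1: "\<And>i x. C1 (block_fun own i (J i) x)"
    and convex: "\<And>i x. convex_on UNIV (block_fun own i (J i) x)"
    and VI: "solves_VI X (pseudo_gradient own J) xs"
  shows "is_GNE own J X xs"
proof -
  have "block_fun own i (J i) xs xs \<le> block_fun own i (J i) xs y" if y: "repl own i y xs \<in> X" for i y
  proof -
    define w where "w = repl own i y xs"
    define g where "g = grad (block_fun own i (J i) xs) xs"
    have g: "GDERIV (block_fun own i (J i) xs) xs :> g"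
      using C1 unfolding g_def C1_def by (blast intro: GDERIV_grad)
    have "(w - xs) \<bullet> g = (w - xs) \<bullet> pseudo_gradient own J xs"
      unfolding inner_vec_def
      by (intro sum.cong) (auto simp: w_def g_def repl_def pseudo_gradient_def)
    also have "\<dots> \<ge> 0" using VI y by (simp add: solves_VI_def w_def)
    finally have "block_fun own i (J i) xs xs \<le> block_fun own i (J i) xs w"
      using convex_on_above_gradient[OF convex g, of w] by simp
    then show ?thesis by (simp add: block_fun_def w_def repl_idem)
  qed
  then show ?thesis
    using VI by (auto simp: is_GNE_def is_arg_min_linorder repl_self solves_VI_def)
qed

text \<open>\<open>F xs\<close> annihilates the kernel of \<open>G\<close>, hence lies in the range
  of the transpose. As \<open>G\<close> is onto, displacements with any prescribed change of the
  constraint values exist, and suitable ones reveal sign and complementarity.\<close>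

lemma VI_polyhedron_multiplier:
  fixes G :: "real^'n::finite^'m::finite"
  assumes surj: "surj ((*v) G)"
    and VI: "solves_VI {x. G *v x - H \<le> 0} F xs"
  obtains a where "F xs + transpose G *v a = 0" "0 \<le> a" "a \<bullet> (H - G *v xs) = 0"
proof -
  have feas: "G *v xs \<le> H" and dir: "\<And>d. G *v (xs + d) \<le> H \<Longrightarrow> d \<bullet> F xs \<ge> 0"
    using VI by (force simp: solves_VI_def less_eq_vec_def)+
  obtain b where b: "transpose G *v b = F xs"
  proof (rule matrix_range_exists)
    fix d assume "transpose (transpose G) *v d = 0"
    then have "G *v d = 0" by simp
    then have "d \<bullet> F xs \<ge> 0" "(- d) \<bullet> F xs \<ge> 0"
      using feas
      by (auto intro!: dir simp: matrix_vector_right_distrib matrix_vector_mult_diff_distrib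
          simp del: inner_minus_left add_uminus_conv_diff
          simp: linear_neg[OF matrix_vector_mul_linear])
    then show "d \<bullet> F xs = 0" by simp
  qed (rule that)
  have dF: "d \<bullet> F xs = (G *v d) \<bullet> b" for d
    unfolding b[symmetric] by (rule inner_matrix_vector_transpose[symmetric])
  have "b $ r \<le> 0" for r
  proof -
    \<comment> \<open>This displacement lowers constraint \<open>r\<close> by one and leaves the
      others unchanged, so it remains feasible.\<close>
    obtain d where d: "- axis r 1 = G *v d" using surjD[OF surj] by blast
    have "G *v (xs + d) \<le> H"
      using feas unfolding matrix_vector_right_distrib d[symmetric]
      unfolding less_eq_vec_def by (simp add: axis_def add_increasing2 diff_le_eq)
    then have "(- axis r 1) \<bullet> b \<ge> 0" using dir dF d by metis
    then show ?thesis by (simp add: inner_axis' )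
  qed
  moreover have "b \<bullet> (H - G *v xs) \<ge> 0"
  proof -
    \<comment> \<open>This displacement uses up all slack and makes every constraint active.\<close>
    obtain d where d: "H - G *v xs = G *v d" using surjD[OF surj] by blast
    have "G *v (xs + d) \<le> H"
      unfolding matrix_vector_right_distrib d[symmetric] by simp
    then show ?thesis using dir dF d by (metis inner_commute)
  qed
  moreover have "b \<bullet> (H - G *v xs) \<le> 0"
    using \<open>\<And>r. b $ r \<le> 0\<close> feas
    by (auto simp: inner_vec_def less_eq_vec_def intro!: sum_nonpos mult_nonpos_nonneg)
  ultimately show thesis
    using b linear_neg[OF matrix_vector_mul_linear, of "transpose G" b]
    by (intro that[of "- b"]) (auto simp: less_eq_vec_def simp del: transpose_matrix_vector)
qed

subsection \<open>The closed-loop dynamics\<close>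

text \<open>The objectives enter the dynamics only through the pseudo-gradient, so \<open>F\<close>
  stands for it abstractly.\<close>

locale gne_dynamics =
  fixes own :: "'n::finite \<Rightarrow> 'p::finite"
    and G :: "real^'n^'m::finite"
    and h :: "'p \<Rightarrow> real^'m"
    and A :: "real^'p^'p"
    and \<mu> \<theta> \<alpha> :: real
    and F :: "real^'n \<Rightarrow> real^'n"
  assumes full_row_rank: "rank G = CARD('m)"
    and mu_pos: "\<mu> > 0"
    and monotone: "strongly_monotone \<mu> F"
    and lipschitz: "\<theta>-lipschitz_on UNIV F"
    and graph: "weighted_graph A" and connected: "connected_graph A"
    and alpha_pos: "\<alpha> > 0" and alpha: "\<alpha> > \<theta>\<^sup>2 / (4 * \<mu>)"
begin

abbreviation "Gd \<equiv> block_diag own G"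
abbreviation "Hs \<equiv> col_stack h"
abbreviation "H \<equiv> \<Sum>i\<in>UNIV. h i"
abbreviation L :: "real^('p \<times> 'm)^('p \<times> 'm)" where "L \<equiv> kron_id (laplacian A)"
abbreviation "W \<equiv> multiplier_residual Gd Hs L \<alpha> F"

abbreviation is_multiplier :: "real^'n \<Rightarrow> real^('p \<times> 'm) \<Rightarrow> real^('p \<times> 'm) \<Rightarrow> bool" where
  "is_multiplier x z l \<equiv> solves_VI {v. 0 \<le> v} (W x z) l"

lemma surj_G: "surj ((*v) G)"
  using full_row_rank full_rank_surjective by blast

lemma transpose_A: "transpose A = A"
  using graph by (simp add: weighted_graph_def)

lemma transpose_L: "transpose L = L"
  by (rule transpose_laplacian[OF transpose_A])

lemma L_nonneg: "v \<bullet> (L *v v) \<ge> 0"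
  by (rule laplacian_nonneg[OF graph])

lemma residual_diff:
  "W x z l - W x z l' = Gd *v (transpose Gd *v (l - l')) + L *v (l - l')"
  unfolding multiplier_residual_def matrix_vector_mult_diff_distrib by simp

lemma residual_quadratic_pos:
  assumes "v \<noteq> 0"
  shows "v \<bullet> (Gd *v (transpose Gd *v v) + L *v v) > 0"
proof (rule ccontr)
  have eq: "v \<bullet> (Gd *v (transpose Gd *v v) + L *v v) = (norm (transpose Gd *v v))\<^sup>2 + v \<bullet> (L *v v)"
    unfolding power2_norm_eq_inner inner_add_right inner_transpose_matrix_vector ..
  assume "\<not> ?thesis"
  then have zero: "(norm (transpose Gd *v v))\<^sup>2 = 0" "v \<bullet> (L *v v) = 0"
    unfolding eq using L_nonneg[of v] zero_le_power2[of "norm (transpose Gd *v v)"] by linarith+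
  obtain a where v: "v = col_stack (\<lambda>_. a)"
    using laplacian_kernel[OF graph connected zero(2)] by blast
  then have "transpose G *v a = 0"
    using zero(1) by (simp add: transpose_block_diag_col_stack del: transpose_matrix_vector)
  \<comment> \<open>Injectivity of the transpose: \<open>a \<bullet> a\<close> equals
    \<open>d \<bullet> (transpose G *v a)\<close>.\<close>
  moreover obtain d where "a = G *v d" using surjD[OF surj_G] by blast
  ultimately have "a \<bullet> a = 0"
    by (metis inner_matrix_vector_transpose inner_zero_right)
  then show False using \<open>v \<noteq> 0\<close> v by (simp add: col_stack_def vec_eq_iff)
qed

text \<open>One modulus serves all states, because the state enters the residual as an additive
  constant.\<close>

lemma residual_monotone:
  obtains q where "q > 0" "\<And>x z. strongly_monotone q (W x z)"
proof -
  have "linear (\<lambda>v. Gd *v (transpose Gd *v v) + L *v v)"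
    by (intro linearI)
       (simp_all add: matrix_vector_right_distrib matrix_vector_mult_scaleR scaleR_add_right
         del: transpose_matrix_vector)
  then obtain q where "q > 0"
      "\<And>v. q * (norm v)\<^sup>2 \<le> v \<bullet> (Gd *v (transpose Gd *v v) + L *v v)"
    using positive_definite_imp_coercive[of "\<lambda>v. Gd *v (transpose Gd *v v) + L *v v"]
      residual_quadratic_pos by blast
  then show thesis
    by (intro that[of q]) (auto simp: strongly_monotone_def residual_diff inner_commute
        simp del: transpose_matrix_vector)
qed

lemma residual_lipschitz: obtains B where "B-lipschitz_on UNIV (W x z)"
proof -
  obtain B where B: "B > 0" "\<And>v. norm ((Gd ** transpose Gd + L) *v v) \<le> norm v * B"
    using bounded_linear.pos_bounded[OF matrix_vector_mul_bounded_linear[of "Gd ** transpose Gd + L"]]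
    by auto
  have "W x z l - W x z l' = (Gd ** transpose Gd + L) *v (l - l')" for l l'
    unfolding residual_diff by (simp add: matrix_vector_mul_assoc matrix_vector_mult_add_rdistrib
        del: transpose_matrix_vector)
  then have "B-lipschitz_on UNIV (W x z)"
    using B by (intro lipschitz_onI) (auto simp: dist_norm mult.commute)
  then show thesis by (rule that)
qed

lemma residual_lipschitz_state:
  obtains C where "\<And>l. C-lipschitz_on UNIV (\<lambda>p. W (fst p) (snd p) l)"
proof -
  obtain B\<^sub>G where B\<^sub>G: "B\<^sub>G-lipschitz_on UNIV ((*v) Gd)" by (rule matrix_vector_mult_lipschitz)
  obtain B\<^sub>L where B\<^sub>L: "B\<^sub>L-lipschitz_on UNIV ((*v) L)" by (rule matrix_vector_mult_lipschitz)
  have fst: "1-lipschitz_on UNIV (fst :: (real^'n) \<times> (real^('p \<times> 'm)) \<Rightarrow> _)"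
    and snd: "1-lipschitz_on UNIV (snd :: (real^'n) \<times> (real^('p \<times> 'm)) \<Rightarrow> _)"
    by (auto intro!: lipschitz_onI simp: dist_Pair_Pair)
  note comp = lipschitz_on_compose2[OF _ lipschitz_on_subset[OF _ subset_UNIV]]
  have "\<exists>C. C-lipschitz_on UNIV (\<lambda>p. Gd *v F (fst p) - \<alpha> *\<^sub>R (Gd *v fst p - Hs) + L *v snd p)"
    \<comment> \<open>The constant stays schematic and is assembled by the composition
      rules.\<close>
    by (rule exI, (rule lipschitz_on_add lipschitz_on_diff lipschitz_on_cmult lipschitz_on_constant
        comp[OF snd B\<^sub>L] comp[OF fst B\<^sub>G] comp[OF comp[OF fst lipschitz] B\<^sub>G] subset_UNIV)+)
  then obtain C where
    "C-lipschitz_on UNIV (\<lambda>p. Gd *v F (fst p) - \<alpha> *\<^sub>R (Gd *v fst p - Hs) + L *v snd p)" ..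
  then have "(0 + C)-lipschitz_on UNIV (\<lambda>p. W (fst p) (snd p) l)" for l
    unfolding multiplier_residual_def by (intro lipschitz_on_add lipschitz_on_constant)
  then show thesis by (rule that)
qed

text \<open>The stability estimate, applied to the residuals at two states, gives the Lipschitz
  constant \<open>C / q\<close>.\<close>

lemma multiplier_map:
  obtains lam K where "K-lipschitz_on UNIV lam"
    "\<And>x z l. is_multiplier x z l \<longleftrightarrow> l = lam (x, z)"
proof -
  obtain q where q: "q > 0" "\<And>x z. strongly_monotone q (W x z)"
    by (rule residual_monotone) blast
  obtain C where C: "\<And>l. C-lipschitz_on UNIV (\<lambda>p. W (fst p) (snd p) l)"
    by (rule residual_lipschitz_state) blast
  have ex: "\<exists>l. is_multiplier x z l" for x z
  proof -
    obtain B where B: "B-lipschitz_on UNIV (W x z)" by (rule residual_lipschitz)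
    have "(0 :: real^('p \<times> 'm)) \<in> {v. 0 \<le> v}" by simp
    then show ?thesis
      using solves_VI_exists[OF q(2,1) B convex_nonneg_vec closed_nonneg_vec] by blast
  qed
  define lam where "lam p = (SOME l. is_multiplier (fst p) (snd p) l)" for p
  have lam: "is_multiplier (fst p) (snd p) (lam p)" for p
    unfolding lam_def by (rule someI_ex[OF ex])
  have "is_multiplier x z l \<longleftrightarrow> l = lam (x, z)" for x z l
    using lam[of "(x, z)"] solves_VI_unique[OF q(2,1)] by auto
  moreover have "(C / q)-lipschitz_on UNIV lam"
  proof (rule lipschitz_onI)
    show "0 \<le> C / q" using lipschitz_on_nonneg[OF C] q by simp
    fix p p'
    have "q * norm (lam p - lam p')
        \<le> norm (W (fst p) (snd p) (lam p') - W (fst p') (snd p') (lam p'))"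
      by (rule solves_VI_stability[OF q(2,1) lam lam])
    also have "\<dots> \<le> C * norm (p - p')"
      using lipschitz_on_normD[OF C] by auto
    finally show "dist (lam p) (lam p') \<le> C / q * dist p p'"
      using q by (simp add: dist_norm field_simps)
  qed
  ultimately show thesis using that by blast
qed

text \<open>Characterizing \<open>f\<close> through \<open>is_multiplier\<close> allows its
  evaluation at any known multiplier, both on a trajectory and at an equilibrium.\<close>

lemma closed_loop_field:
  obtains f K where "K-lipschitz_on UNIV f"
    "\<And>x z l. is_multiplier x z l \<Longrightarrow> f (x, z) = (- F x - transpose Gd *v l, L *v l)"
    "\<And>x z. \<exists>l. is_multiplier x z l"
proof -
  obtain lam K where K: "K-lipschitz_on UNIV lam"
    and lam: "\<And>x z l. is_multiplier x z l \<longleftrightarrow> l = lam (x, z)"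
    by (rule multiplier_map) blast
  obtain B\<^sub>G where B\<^sub>G: "B\<^sub>G-lipschitz_on UNIV ((*v) (transpose Gd))" by (rule matrix_vector_mult_lipschitz)
  obtain B\<^sub>L where B\<^sub>L: "B\<^sub>L-lipschitz_on UNIV ((*v) L)" by (rule matrix_vector_mult_lipschitz)
  have fst: "1-lipschitz_on UNIV (fst :: (real^'n) \<times> (real^('p \<times> 'm)) \<Rightarrow> _)"
    by (auto intro!: lipschitz_onI simp: dist_Pair_Pair)
  note comp = lipschitz_on_compose2[OF _ lipschitz_on_subset[OF _ subset_UNIV]]
  have "\<exists>K'. K'-lipschitz_on UNIV (\<lambda>p. (- F (fst p) - transpose Gd *v lam p, L *v lam p))"
    by (rule exI, (rule lipschitz_on_Pair lipschitz_on_diff lipschitz_on_minus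
        comp[OF K B\<^sub>L] comp[OF K B\<^sub>G] comp[OF fst lipschitz] subset_UNIV)+)
  then obtain K' where "K'-lipschitz_on UNIV (\<lambda>p. (- F (fst p) - transpose Gd *v lam p, L *v lam p))" ..
  then show thesis
    by (rule that) (auto simp: lam)
qed

definition closed_loop ::
  "(real \<Rightarrow> real^'n) \<Rightarrow> (real \<Rightarrow> real^('p \<times> 'm)) \<Rightarrow> (real \<Rightarrow> real^('p \<times> 'm)) \<Rightarrow> bool" where
  "closed_loop x z l \<longleftrightarrow> (\<forall>t\<ge>0.
     (x has_vector_derivative (- F (x t) - transpose Gd *v l t)) (at t within {0..}) \<and>
     (z has_vector_derivative (L *v l t)) (at t within {0..}) \<and>
     is_multiplier (x t) (z t) (l t))"

lemma closed_loop_exists: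
  obtains x z l where "closed_loop x z l" "x 0 = x0" "z 0 = z0"
proof -
  obtain f K where K: "K-lipschitz_on UNIV f"
    and f: "\<And>x z l. is_multiplier x z l \<Longrightarrow> f (x, z) = (- F x - transpose Gd *v l, L *v l)"
    and ex: "\<And>x z. \<exists>l. is_multiplier x z l"
    by (rule closed_loop_field) blast
  obtain y where y0: "y 0 = (x0, z0)"
    and y: "\<And>t. t \<ge> 0 \<Longrightarrow> (y has_vector_derivative f (y t)) (at t within {0..})"
    by (rule lipschitz_ode_global_solution[OF K]) blast
  have "\<exists>l. \<forall>t. is_multiplier (fst (y t)) (snd (y t)) (l t)"
    by (intro choice allI ex)
  then obtain l where l: "\<And>t. is_multiplier (fst (y t)) (snd (y t)) (l t)" by blast
  have "closed_loop (\<lambda>t. fst (y t)) (\<lambda>t. snd (y t)) l"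
    unfolding closed_loop_def
  proof (intro allI impI conjI l)
    fix t :: real assume "t \<ge> 0"
    have fy: "f (y t) = (- F (fst (y t)) - transpose Gd *v l t, L *v l t)"
      using f[OF l[of t]] by simp
    show "((\<lambda>t. fst (y t)) has_vector_derivative - F (fst (y t)) - transpose Gd *v l t) (at t within {0..})"
      using bounded_linear.has_vector_derivative[OF bounded_linear_fst y[OF \<open>t \<ge> 0\<close>]]
      by (simp add: fy)
    show "((\<lambda>t. snd (y t)) has_vector_derivative L *v l t) (at t within {0..})"
      using bounded_linear.has_vector_derivative[OF bounded_linear_snd y[OF \<open>t \<ge> 0\<close>]]
      by (simp add: fy)
  qed
  then show thesis by (rule that) (simp_all add: y0)
qed

text \<open>The velocity of \<open>x\<close> is made explicit; in this form the residual is the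
  vector \<open>w\<close> of the opening sketch.\<close>

lemma residual_alt:
  "W x z l = - (Gd *v (- F x - transpose Gd *v l)) - \<alpha> *\<^sub>R (Gd *v x - Hs) + L *v z + L *v l"
  by (simp add: multiplier_residual_def matrix_vector_mult_diff_distrib
      linear_neg[OF matrix_vector_mul_linear] del: transpose_matrix_vector)

text \<open>Raising entry \<open>k\<close> of \<open>l\<close> stays in the orthant and isolates
  entry \<open>k\<close> of the residual.\<close>

lemma multiplier_residual_nonneg:
  assumes "is_multiplier x z l"
  shows "W x z l $ k \<ge> 0"
proof -
  have "0 \<le> l + axis k 1"
    using assms by (simp add: solves_VI_def less_eq_vec_def axis_def)
  then have "(l + axis k 1 - l) \<bullet> W x z l \<ge> 0"
    using assms unfolding solves_VI_def by blast
  then show ?thesis by (simp add: inner_axis')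
qed

lemma forward_invariant:
  assumes cl: "closed_loop x z l" and "x 0 \<in> feasible_set G h" and "t \<ge> 0"
  shows "x t \<in> feasible_set G h"
proof -
  have "(G *v x t - H) $ r \<le> 0" for r
  proof -
    define s' where "s' t = (G *v (- F (x t) - transpose Gd *v l t)) $ r" for t
    have deriv: "((\<lambda>t. (G *v x t - H) $ r) has_real_derivative s' t) (at t within {0..})"
      if "t \<ge> 0" for t
    proof -
      have "(x has_vector_derivative (- F (x t) - transpose Gd *v l t)) (at t within {0..})"
        using cl that by (simp add: closed_loop_def)
      from bounded_linear.has_vector_derivative[OF bounded_linear_vec_nth[of r]
          bounded_linear.has_vector_derivative[OF matrix_vector_mul_bounded_linear[of G] this]]
      show ?thesis
        unfolding has_real_derivative_iff_has_vector_derivative s'_def vector_minus_component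
        by (rule has_vector_derivative_diff_const[THEN iffD2])
    qed
    have decay: "s' t + \<alpha> * (G *v x t - H) $ r \<le> 0" if "t \<ge> 0" for t
    proof -
      have "0 \<le> (\<Sum>i\<in>UNIV. W (x t) (z t) (l t) $ (i, r))"
        using cl that by (intro sum_nonneg multiplier_residual_nonneg) (simp add: closed_loop_def)
      also have "\<dots> = - s' t - \<alpha> * (G *v x t - H) $ r"
        unfolding residual_alt s'_def
        by (simp only: vector_add_component vector_minus_component vector_uminus_component
            vector_scaleR_component sum.distrib sum_subtractf sum_negf block_diag_sum_blocks
            laplacian_sum_blocks[OF transpose_A] col_stack_sum_blocks sum_distrib_left[symmetric]
            real_scaleR_def)
      finally show ?thesis by simp
    qed
    \<comment> \<open>The integrating factor turns the differential inequality into monotonicity, so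
      the sign at time zero persists.\<close>
    have "exp (\<alpha> * t) * (G *v x t - H) $ r \<le> exp (\<alpha> * 0) * (G *v x 0 - H) $ r"
    proof (rule nonincreasing_half_line[where V = "\<lambda>t. exp (\<alpha> * t) * (G *v x t - H) $ r"
          and V' = "\<lambda>t. exp (\<alpha> * t) * (s' t + \<alpha> * (G *v x t - H) $ r)"])
      fix t :: real assume "t \<ge> 0"
      then show "((\<lambda>t. exp (\<alpha> * t) * (G *v x t - H) $ r) has_real_derivative
          exp (\<alpha> * t) * (s' t + \<alpha> * (G *v x t - H) $ r)) (at t within {0..})"
        by (auto intro!: derivative_eq_intros deriv simp del: vector_minus_component
            simp: algebra_simps)
    qed (use \<open>t \<ge> 0\<close> decay in \<open>auto simp: mult_le_0_iff\<close>)
    also have "\<dots> \<le> 0"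
      using \<open>x 0 \<in> feasible_set G h\<close> by (simp add: feasible_set_def less_eq_vec_def)
    finally show ?thesis by (simp only: mult_le_0_iff) auto
  qed
  then show ?thesis by (simp add: feasible_set_def less_eq_vec_def)
qed

text \<open>The slack \<open>H - G *v xs\<close> is shared equally among the players, which is possible because
  the Laplacian maps onto all stacked vectors with zero block sum.\<close>

lemma equilibrium_exists:
  assumes VI: "solves_VI (feasible_set G h) F xs"
  obtains zs ls where "is_multiplier xs zs ls" "- F xs - transpose Gd *v ls = 0" "L *v ls = 0"
proof -
  obtain a where a: "F xs + transpose G *v a = 0" "0 \<le> a" "a \<bullet> (H - G *v xs) = 0"
    using VI_polyhedron_multiplier[OF surj_G VI[unfolded feasible_set_def]] by metis
  define ls :: "real^('p \<times> 'm)" where "ls = col_stack (\<lambda>_. a)"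
  define ws :: "real^('p \<times> 'm)" where "ws = col_stack (\<lambda>_. (\<alpha> / real CARD('p)) *\<^sub>R (H - G *v xs))"
  have ws_sum: "(\<Sum>i\<in>UNIV. ws $ (i, r)) = \<alpha> * (H - G *v xs) $ r" for r
    by (simp add: ws_def col_stack_def)
  \<comment> \<open>The solvability condition for \<open>zs\<close>, which is chosen so that the
    residual at the equilibrium is \<open>ws\<close>.\<close>
  have "(\<Sum>i\<in>UNIV. (\<alpha> *\<^sub>R (Gd *v xs - Hs) + ws) $ (i, r)) = 0" for r
    by (simp only: vector_add_component vector_minus_component ws_sum
        vector_scaleR_component sum.distrib sum_subtractf block_diag_sum_blocks
        col_stack_sum_blocks sum_distrib_left[symmetric] real_scaleR_def)
       (simp only: right_diff_distrib diff_add_cancel diff_self add_diff_eq)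
  then obtain zs where zs: "L *v zs = \<alpha> *\<^sub>R (Gd *v xs - Hs) + ws"
    using laplacian_range[OF graph connected] by metis
  have stat: "- F xs - transpose Gd *v ls = 0"
    using a(1) unfolding ls_def transpose_block_diag_col_stack
    by (metis add_eq_0_iff2 diff_self minus_diff_eq minus_minus diff_minus_eq_add add.commute neg_equal_0_iff_equal)
  have L_ls: "L *v ls = 0" unfolding ls_def by (rule laplacian_col_stack)
  have W: "W xs zs ls = ws"
    unfolding residual_alt stat L_ls zs by simp
  have "(v - ls) \<bullet> ws \<ge> 0" if "0 \<le> v" for v
  proof -
    have "G *v xs \<le> H"
      using VI by (simp add: solves_VI_def feasible_set_def)
    then have "0 \<le> ws"
      using alpha_pos by (auto simp: ws_def col_stack_def less_eq_vec_def)
    then have "v \<bullet> ws \<ge> 0"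
      using that by (auto simp: inner_vec_def less_eq_vec_def intro!: sum_nonneg)
    moreover have "ls \<bullet> ws = (\<Sum>i\<in>(UNIV::'p set). (\<alpha> / real CARD('p)) * (a \<bullet> (H - G *v xs)))"
      unfolding inner_vec_def sum_UNIV_prod sum_distrib_left
      by (intro sum.cong refl) (simp add: ls_def ws_def col_stack_def)
    ultimately show ?thesis using a(3) by (simp add: inner_diff_left)
  qed
  moreover have "0 \<le> ls" using a(2) by (simp add: ls_def col_stack_def less_eq_vec_def)
  ultimately have "is_multiplier xs zs ls" by (simp add: solves_VI_def W)
  then show thesis using stat L_ls by (rule that)
qed

text \<open>The left-hand side is the derivative of the Lyapunov function, estimated at a single
  instant. The lower bound on \<open>\<alpha>\<close> makes the decay rate positive.\<close>

lemma dissipation_inequality: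
  assumes m: "is_multiplier x z l" and ms: "is_multiplier xs zs ls"
    and stat: "- F xs - transpose Gd *v ls = 0" and cons: "L *v ls = 0"
    and x': "x' = - F x - transpose Gd *v l"
  shows "\<alpha> * ((x - xs) \<bullet> x') + (z - zs) \<bullet> (L *v l) \<le> - (\<alpha> * \<mu> - \<theta>\<^sup>2 / 4) * (norm (x - xs))\<^sup>2"
proof -
  define e where "e = x - xs"
  define \<Delta> where "\<Delta> = F x - F xs"
  define d where "d = l - ls"
  have L_d: "L *v d = L *v l" by (simp add: d_def matrix_vector_mult_diff_distrib cons)
  have "transpose Gd *v d = (- F xs - transpose Gd *v ls) - (- F x - transpose Gd *v l) + (F xs - F x)"
    by (simp add: d_def matrix_vector_mult_diff_distrib del: transpose_matrix_vector)
  then have Gd_d: "transpose Gd *v d = - x' - \<Delta>"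
    unfolding stat x'[symmetric] by (simp add: \<Delta>_def)
  \<comment> \<open>Each multiplier is tested in the variational inequality of the other.\<close>
  have "0 \<le> (ls - l) \<bullet> W x z l" "0 \<le> (l - ls) \<bullet> W xs zs ls"
    using m ms by (simp_all add: solves_VI_def)
  then have "d \<bullet> (W x z l - W xs zs ls) \<le> 0"
    by (simp add: d_def inner_diff_left inner_diff_right)
  also have "W x z l - W xs zs ls = - (Gd *v (x' + \<alpha> *\<^sub>R e)) + L *v (z - zs) + L *v l"
    unfolding residual_alt stat cons x'[symmetric]
    by (simp add: e_def matrix_vector_right_distrib matrix_vector_mult_diff_distrib
        matrix_vector_mult_scaleR algebra_simps)
  also have "d \<bullet> \<dots> = - ((transpose Gd *v d) \<bullet> (x' + \<alpha> *\<^sub>R e)) + (L *v d) \<bullet> (z - zs) + d \<bullet> (L *v d)"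
    using inner_transpose_matrix_vector[of L d "z - zs"] transpose_L
    by (simp add: inner_add_right inner_diff_right inner_transpose_matrix_vector L_d
        matrix_vector_right_distrib matrix_vector_mult_scaleR del: transpose_matrix_vector)
  also have "\<dots> = (x' + \<Delta>) \<bullet> (x' + \<alpha> *\<^sub>R e) + (z - zs) \<bullet> (L *v l) + d \<bullet> (L *v d)"
    unfolding Gd_d L_d
    by (simp add: inner_commute inner_add_left inner_add_right inner_diff_left inner_diff_right algebra_simps)
  finally have "\<alpha> * (e \<bullet> x') + (z - zs) \<bullet> (L *v l) \<le> - (x' \<bullet> x') - \<Delta> \<bullet> x' - \<alpha> * (\<Delta> \<bullet> e)"
    using L_nonneg[of d] by (simp add: inner_add_left inner_add_right inner_commute distrib_left)
  moreover have "\<alpha> * (\<mu> * (norm e)\<^sup>2) \<le> \<alpha> * (\<Delta> \<bullet> e)"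
    using monotone alpha_pos by (simp add: strongly_monotone_def \<Delta>_def e_def)
  \<comment> \<open>Completing the square; this is the source of the factor four in the threshold
    for \<open>\<alpha>\<close>.\<close>
  moreover have "- (x' \<bullet> x') - \<Delta> \<bullet> x' \<le> (norm \<Delta>)\<^sup>2 / 4"
    using zero_le_power2[of "norm (x' + (1/2) *\<^sub>R \<Delta>)"]
    unfolding power2_norm_eq_inner by (simp add: inner_add_left inner_add_right inner_commute)
  moreover have "(norm \<Delta>)\<^sup>2 \<le> \<theta>\<^sup>2 * (norm e)\<^sup>2"
    using lipschitz_on_normD[OF lipschitz, of x xs]
    by (simp add: \<Delta>_def e_def power_mono flip: power_mult_distrib)
  ultimately show ?thesis
    unfolding e_def[symmetric] by (simp add: algebra_simps)
qed

text \<open>The Lyapunov function bounds the whole state, hence the velocity through the Lipschitz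
  field. This makes \<open>x\<close> Lipschitz in time, while the decay controls
  \<open>x - xs\<close>.\<close>

lemma closed_loop_converges:
  assumes cl: "closed_loop x z l" and VI: "solves_VI (feasible_set G h) F xs"
  shows "(x \<longlongrightarrow> xs) at_top"
proof -
  obtain zs ls where ms: "is_multiplier xs zs ls"
    and stat: "- F xs - transpose Gd *v ls = 0" and cons: "L *v ls = 0"
    by (rule equilibrium_exists[OF VI])
  obtain f K where K: "K-lipschitz_on UNIV f"
    and f: "\<And>x z l. is_multiplier x z l \<Longrightarrow> f (x, z) = (- F x - transpose Gd *v l, L *v l)"
    by (rule closed_loop_field) blast
  define x' where "x' t = - F (x t) - transpose Gd *v l t" for t
  have x: "\<And>t. t \<ge> 0 \<Longrightarrow> (x has_vector_derivative x' t) (at t within {0..})"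
    and z: "\<And>t. t \<ge> 0 \<Longrightarrow> (z has_vector_derivative L *v l t) (at t within {0..})"
    and m: "\<And>t. t \<ge> 0 \<Longrightarrow> is_multiplier (x t) (z t) (l t)"
    using cl by (simp_all add: closed_loop_def x'_def)
  define V where "V t = \<alpha> / 2 * ((x t - xs) \<bullet> (x t - xs)) + 1 / 2 * ((z t - zs) \<bullet> (z t - zs))" for t
  define V' where "V' t = \<alpha> * ((x t - xs) \<bullet> x' t) + (z t - zs) \<bullet> (L *v l t)" for t
  have V: "(V has_real_derivative V' t) (at t within {0..})" if "t \<ge> 0" for t
    unfolding V_def has_field_derivative_def V'_def
    using x[OF that] z[OF that] unfolding has_vector_derivative_def
    by (auto intro!: derivative_eq_intros simp: fun_eq_iff inner_commute algebra_simps)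
  define c where "c = \<alpha> * \<mu> - \<theta>\<^sup>2 / 4"
  have "c > 0" using alpha mu_pos by (simp add: c_def field_simps)
  have decay: "V' t \<le> - c * (norm (x t - xs))\<^sup>2" if "t \<ge> 0" for t
    unfolding V'_def c_def
    using dissipation_inequality[OF m[OF that] ms stat cons x'_def] by simp
  have V_nonneg: "V t \<ge> 0" for t using alpha_pos by (simp add: V_def)
  have V_le: "V t \<le> V 0" if "t \<ge> 0" for t
    using that \<open>c > 0\<close> by (intro nonincreasing_half_line[OF V]) (auto intro!: order_trans[OF decay])
  \<comment> \<open>The two summands of \<open>V\<close> bound the squared deviations of
    \<open>x\<close> and \<open>z\<close> by \<open>2 * V 0 / \<alpha>\<close> and
    \<open>2 * V 0\<close>.\<close>
  define R where "R = sqrt (2 * V 0 / \<alpha> + 2 * V 0)"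
  have dist_le: "norm ((x t, z t) - (xs, zs)) \<le> R" if "t \<ge> 0" for t
  proof -
    have "\<alpha> / 2 * (norm (x t - xs))\<^sup>2 + 1 / 2 * (norm (z t - zs))\<^sup>2 \<le> V 0"
      using V_le[OF that] unfolding V_def[of t] power2_norm_eq_inner .
    moreover have "0 \<le> \<alpha> / 2 * (norm (x t - xs))\<^sup>2" "0 \<le> 1 / 2 * (norm (z t - zs))\<^sup>2"
      using alpha_pos by simp_all
    ultimately have "\<alpha> / 2 * (norm (x t - xs))\<^sup>2 \<le> V 0" "1 / 2 * (norm (z t - zs))\<^sup>2 \<le> V 0"
      by linarith+
    then have "(norm (x t - xs))\<^sup>2 + (norm (z t - zs))\<^sup>2 \<le> 2 * V 0 / \<alpha> + 2 * V 0"
      using alpha_pos by (intro add_mono) (simp_all add: field_simps)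
    then show ?thesis by (simp add: R_def norm_Pair)
  qed
  have x'_bound: "norm (x' t) \<le> K * R" if "t \<ge> 0" for t
  proof -
    \<comment> \<open>The field vanishes at the equilibrium, so its Lipschitz bound controls the
      velocity itself.\<close>
    have "f (x t, z t) - f (xs, zs) = (x' t, L *v l t)"
      unfolding f[OF m[OF that]] f[OF ms] stat cons x'_def by simp
    then have "norm (x' t) \<le> norm (f (x t, z t) - f (xs, zs))"
      by (simp add: norm_Pair)
    also have "\<dots> \<le> K * norm ((x t, z t) - (xs, zs))"
      by (rule lipschitz_on_normD[OF K]) auto
    also have "\<dots> \<le> K * R"
      using dist_le[OF that] lipschitz_on_nonneg[OF K] by (rule mult_left_mono)
    finally show ?thesis .
  qed
  have "(K * R)-lipschitz_on {0..} (\<lambda>t. x t - xs)"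
    using x x'_bound
    by (intro lipschitz_half_line[where e' = x']) (auto simp: has_vector_derivative_diff_const)
  then have "((\<lambda>t. x t - xs) \<longlongrightarrow> 0) at_top"
    using V decay \<open>c > 0\<close> V_nonneg by (intro lyapunov_tendsto_zero[where V = V and V' = V'])
  then show ?thesis by (rule LIM_zero_cancel)
qed

end

section \<open>The feasible polyhedron and convergence to the equilibrium of the game\<close>

lemma feasible_set_eq_halfspaces:
  "feasible_set G h = (\<Inter>r. {x. row r G \<bullet> x \<le> (\<Sum>i\<in>UNIV. h i) $ r})"
  by (auto simp: feasible_set_def less_eq_vec_def matrix_vector_mul_component row_def vec_nth_inverse)

lemma convex_feasible_set: "convex (feasible_set G h)"
  unfolding feasible_set_eq_halfspaces by (simp add: convex_INT convex_halfspace_le)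

lemma closed_feasible_set: "closed (feasible_set G h)"
  unfolding feasible_set_eq_halfspaces by (simp add: closed_INT closed_halfspace_le)

text \<open>Existence of a trajectory from every feasible start is included, so that the statement
  about all trajectories is not vacuous.\<close>

theorem theorem3p7:
  fixes own :: "'n::finite \<Rightarrow> 'p::finite"
    and J :: "'p \<Rightarrow> real^'n \<Rightarrow> real"
    and G :: "real^'n^'m::finite"
    and h :: "'p \<Rightarrow> real^'m"
    and A :: "real^'p^'p"
    and \<mu> \<theta> \<alpha> :: real
  assumes J_C1: "\<And>i x. C1 (block_fun own i (J i) x)"
    and J_convex: "\<And>i x. convex_on UNIV (block_fun own i (J i) x)"
    and slater: "slater G h"
    and full_row_rank: "rank G = CARD('m)"
    and "\<mu> > 0" and "\<theta> > 0"
    and monotone: "strongly_monotone \<mu> (pseudo_gradient own J)"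
    and lipschitz: "\<theta>-lipschitz_on UNIV (pseudo_gradient own J)"
    and graph: "weighted_graph A" and connected: "connected_graph A"
    and "\<alpha> > 0" and alpha: "\<alpha> > \<theta>\<^sup>2 / (4 * \<mu>)"
  shows "\<exists>xs. is_vGNE own J (feasible_set G h) xs \<and>
    (\<forall>y. is_vGNE own J (feasible_set G h) y \<longrightarrow> y = xs) \<and>
    (\<forall>x0 \<in> feasible_set G h. \<forall>z0.
      (\<exists>x z l. trajectory own J G h A \<alpha> x z l \<and> x 0 = x0 \<and> z 0 = z0) \<and>
      (\<forall>x z l. trajectory own J G h A \<alpha> x z l \<and> x 0 = x0 \<and> z 0 = z0 \<longrightarrow>
        (x \<longlongrightarrow> xs) at_top \<and> (\<forall>t\<ge>0. x t \<in> feasible_set G h)))"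
proof -
  interpret gne_dynamics own G h A \<mu> \<theta> \<alpha> "pseudo_gradient own J"
    using assms by unfold_locales
  have trajectory: "trajectory own J G h A \<alpha> x z l \<longleftrightarrow> closed_loop x z l" for x z l
    unfolding trajectory_def closed_loop_def Let_def
      multiplier_arg_min_iff_VI[OF transpose_L L_nonneg] ..
  have "feasible_set G h \<noteq> {}"
    using slater by (force simp: slater_def feasible_set_def less_eq_vec_def intro: less_imp_le)
  then obtain xs where xs: "solves_VI (feasible_set G h) (pseudo_gradient own J) xs"
    by (rule solves_VI_exists[OF monotone \<open>\<mu> > 0\<close> lipschitz convex_feasible_set closed_feasible_set])
  have "is_vGNE own J (feasible_set G h) xs"
    using xs VI_imp_GNE[OF J_C1 J_convex xs] by (simp add: is_vGNE_def)
  moreover have "y = xs" if "is_vGNE own J (feasible_set G h) y" for y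
    using solves_VI_unique[OF monotone \<open>\<mu> > 0\<close> _ xs] that by (simp add: is_vGNE_def)
  moreover have "\<exists>x z l. trajectory own J G h A \<alpha> x z l \<and> x 0 = x0 \<and> z 0 = z0" for x0 z0
    unfolding trajectory by (metis closed_loop_exists)
  ultimately show ?thesis
    using closed_loop_converges[OF _ xs] forward_invariant unfolding trajectory by blast
qed

end
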